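(* Let $\mathfrak{g}=(\mathfrak{g}_{-1}\xrightarrow{l_1}\mathfrak{g}_0,\ l_2=l_2^0+l_2^1,\ l_3)$ be a $2$-term $L_\infty$-algebra, let $(A,\delta,\phi)$ with $A=\mathfrak{g}_{-1}^*\times\mathfrak{g}_0^*\to\mathfrak{g}_{-1}^*$ be the Lie quasi-bialgebroid associated to it, and let $\Gamma:\mathfrak{g}_{-1}^*\times\mathfrak{g}_0^*\rightrightarrows\mathfrak{g}_{-1}^*$ be the action groupoid integrating $A$. Then the quasi-Poisson groupoid corresponding to $(A,\delta,\phi)$ is $(\Gamma,\Pi,\phi=-l_3)$, where the bivector field $\Pi$ on $\mathfrak{g}_{-1}^*\times\mathfrak{g}_0^*$ is characterized by $$\Pi(dx,dy)=-l_2^0(x,y),\qquad \Pi(dx,dm)=-l_2^1(x,m),\qquad \Pi(dm,dn)=-l_2^1(l_1(m),n),$$ where $d$ is the de Rham differential and $x,y\in\mathfrak{g}_0$, $m,n\in\mathfrak{g}_{-1}$ are regarded as linear functions on $\mathfrak{g}_{-1}^*\times\mathfrak{g}_0^*$.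
   Context: All vector spaces are real and finite-dimensional. A $2$-term $L_\infty$-algebra $(\mathfrak{g}_{-1}\xrightarrow{l_1}\mathfrak{g}_0,l_2=l_2^0+l_2^1,l_3)$ consists of a linear map $l_1:\mathfrak{g}_{-1}\to\mathfrak{g}_0$, maps $l_2^0:\wedge^2\mathfrak{g}_0\to\mathfrak{g}_0$, $l_2^1:\mathfrak{g}_0\otimes\mathfrak{g}_{-1}\to\mathfrak{g}_{-1}$ (with $l_2(m,x)=-l_2(x,m)$, $l_2(m,n)=0$) and $l_3:\wedge^3\mathfrak{g}_0\to\mathfrak{g}_{-1}$, with, for $x,y,z,x_i\in\mathfrak{g}_0$, $m,n\in\mathfrak{g}_{-1}$: $l_1l_2(x,m)=l_2(x,l_1m)$; $l_2(l_1m,n)=l_2(m,l_1n)$; $l_2(l_2(x,y),z)+c.p.+l_1l_3(x,y,z)=0$; $l_2(l_2(x,y),m)+l_2(l_2(y,m),x)+l_2(l_2(m,x),y)+l_3(x,y,l_1m)=0$; $\sum_{\sigma}\mathrm{sgn}(\sigma)l_3(l_2(x_{\sigma(1)},x_{\sigma(2)}),x_{\sigma(3)},x_{\sigma(4)})=\sum_{\tau}\mathrm{sgn}(\tau)l_2(l_3(x_{\tau(1)},x_{\tau(2)},x_{\tau(3)}),x_{\tau(4)})$, $\sigma$ over $(2,2)$- and $\tau$ over $(3,1)$-unshuffles. "$c.p.$" denotes cyclic permutations. Define $l_1^*:\mathfrak{g}_0^*\to\mathfrak{g}_{-1}^*$ by $\langle l_1^*\xi,m\rangle=-\langle\xi,l_1(m)\rangle$.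 The Lie quasi-bialgebroid $(A,\delta,\phi)$: $A$ is the action Lie algebroid of the abelian Lie algebra $\mathfrak{g}_0^*$ acting on $\mathfrak{g}_{-1}^*$ by constant vector fields, with anchor $\rho_A(\xi)=-l_1^*(\xi)$ and $[\xi,\eta]_A=0$ for constant sections $\xi,\eta\in\mathfrak{g}_0^*$. On $A^*=\mathfrak{g}_{-1}^*\times\mathfrak{g}_0$ there are the anchor $\rho_{A^*}$ and bracket $[\cdot,\cdot]_{A^*}$ (Leibniz rule, not necessarily Jacobi) with $\rho_{A^*}(x)(m)=l_2^1(x,m)$, $[x,y]_{A^*}=l_2^0(x,y)$ for constant sections $x,y\in\mathfrak{g}_0$ and linear functions $m\in\mathfrak{g}_{-1}$. $\delta:\Gamma(\wedge^kA)\to\Gamma(\wedge^{k+1}A)$ is the generalized Chevalley-Eilenberg operator determined by $\rho_{A^*}$ and $[\cdot,\cdot]_{A^*}$: a degree $1$ derivation with $(\delta f)(u)=\rho_{A^*}(u)f$ and $(\delta e)(u,v)=\rho_{A^*}(u)\langle e,v\rangle-\rho_{A^*}(v)\langle e,u\rangle-\langle e,[u,v]_{A^*}\rangle$ for $u,v\in\Gamma(A^* )$, $e\in\Gamma(A)$. Finally $\phi=-l_3\in\wedge^3\mathfrak{g}_0^*\otimes\mathfrak{g}_{-1}\subset\Gamma(\wedge^3A)$. The groupoid $\Gamma$: source $s(\alpha,\xi)=\alpha$, target $t(\alpha,\xi)=\alpha+l_1^*\xi$, inclusion $\alpha\mapsto(\alpha,0)$, product $(\alpha,\xi)(\alpha+l_1^*\xi,\eta)=(\alpha,\xi+\eta)$.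 For $e\in\Gamma(A)$, regarded as a map $\mathfrak{g}_{-1}^*\to\mathfrak{g}_0^*$, the left and right translations are the vector fields $\overleftarrow{e}_{(\alpha,\xi)}=(0,e(\alpha+l_1^*\xi))$ and $\overrightarrow{e}_{(\alpha,\xi)}=(-l_1^*(e(\alpha)),e(\alpha))$; similarly for $\Gamma(\wedge^kA)$, with functions $f$ translated to $t^*f$ on the left and $s^*f$ on the right. A quasi-Poisson groupoid is a triple $(\Gamma,\Pi,\phi)$ where $\Gamma$ is a Lie groupoid with Lie algebroid $A$, $\Pi$ is a multiplicative bivector field on $\Gamma$ and $\phi\in\Gamma(\wedge^3A)$, such that $\frac12[\Pi,\Pi]_S=\overleftarrow{\phi}-\overrightarrow{\phi}$ and $[\Pi,\overleftarrow{\phi}]_S=0$ ($[\cdot,\cdot]_S$ the Schouten bracket). Its corresponding Lie quasi-bialgebroid is $(A,\delta_\Pi,\phi)$, where $\delta_\Pi$ is defined by $\overleftarrow{\delta_\Pi f}=\Pi(d(t^*f),\cdot)$ for $f\in C^\infty(M)$, $M$ the base of $\Gamma$, and $\overleftarrow{\delta_\Pi e}=L_{\overleftarrow{e}}\Pi$ for $e\in\Gamma(A)$. "The quasi-Poisson groupoid corresponding to $(A,\delta,\phi)$" means the one on $\Gamma$ with $\delta_\Pi=\delta$ and trisection $\phi$. *)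

theory Defs
  imports "HOL-Analysis.Analysis" "HOL-Combinatorics.Permutations"
begin

section \<open>Smooth maps and multivector fields on vector spaces\<close>

text \<open>
  All manifolds that occur are finite-dimensional real vector spaces. They are types of class
  \<open>real_normed_vector\<close> that are assumed finite-dimensional where it matters. All norms are then
  equivalent, so nothing depends on the norm, and \<open>'a \<Rightarrow>\<^sub>L real\<close> is the full dual of \<open>'a\<close>. (The class
  \<open>euclidean_space\<close> would exclude the zero space.)
\<close>

fun differentiable_upto :: "nat \<Rightarrow> ('a::real_normed_vector \<Rightarrow> 'b::real_normed_vector) \<Rightarrow> bool" where
  "differentiable_upto 0 f \<longleftrightarrow> continuous_on UNIV f"
| "differentiable_upto (Suc k) f \<longleftrightarrow>
     (\<forall>p. f differentiable (at p)) \<and> (\<forall>v. differentiable_upto k (\<lambda>p. frechet_derivative f (at p) v))"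

definition smooth :: "('a::real_normed_vector \<Rightarrow> 'b::real_normed_vector) \<Rightarrow> bool" where
  "smooth f \<longleftrightarrow> (\<forall>k. differentiable_upto k f)"

text \<open>The differential \<open>df\<close> of a real function at a point, as a covector.\<close>

definition differential :: "('a::real_normed_vector \<Rightarrow> real) \<Rightarrow> 'a \<Rightarrow> 'a \<Rightarrow>\<^sub>L real" where
  "differential f p = Blinfun (frechet_derivative f (at p))"

text \<open>
  A \<open>k\<close>-form is an alternating \<open>k\<close>-linear function of the entries of a list of length \<open>k\<close>, with the
  dummy value 0 on lists of other lengths, so that equality of forms is equality of functions.
\<close>

definition alternating_form :: "nat \<Rightarrow> ('u::real_vector list \<Rightarrow> real) \<Rightarrow> bool" where
  "alternating_form k \<omega> \<longleftrightarrow>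
     (\<forall>us. length us \<noteq> k \<longrightarrow> \<omega> us = 0) \<and>
     (\<forall>us. length us = k \<longrightarrow> (\<forall>i<k. linear (\<lambda>u. \<omega> (us[i := u])))) \<and>
     (\<forall>us. length us = k \<longrightarrow> (\<forall>i<k. \<forall>j<k. i \<noteq> j \<and> us ! i = us ! j \<longrightarrow> \<omega> us = 0))"

text \<open>
  A section of \<open>\<And>\<^sup>k E\<close>, for a trivial vector bundle \<open>E\<close> over \<open>'a\<close>, is a smooth field of \<open>k\<close>-forms on the
  fibre \<open>'u\<close> of the dual bundle. Here \<open>(X \<and> Y)[\<theta>, \<eta>] = \<theta>(X) \<eta>(Y) - \<theta>(Y) \<eta>(X)\<close>.
\<close>

definition wedge_section :: "nat \<Rightarrow> ('a::real_normed_vector \<Rightarrow> 'u::real_vector list \<Rightarrow> real) \<Rightarrow> bool" where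
  "wedge_section k P \<longleftrightarrow> (\<forall>p. alternating_form k (P p)) \<and> (\<forall>us. smooth (\<lambda>p. P p us))"

type_synonym 'a mvf = "'a \<Rightarrow> ('a \<Rightarrow>\<^sub>L real) list \<Rightarrow> real"

abbreviation multivector_field :: "nat \<Rightarrow> 'a::real_normed_vector mvf \<Rightarrow> bool" where
  "multivector_field k P \<equiv> wedge_section k P"

definition vector_field_mvf :: "('a \<Rightarrow> 'a) \<Rightarrow> 'a::real_normed_vector mvf" where
  "vector_field_mvf X p \<theta>s = (if length \<theta>s = 1 then blinfun_apply (hd \<theta>s) (X p) else 0)"

text \<open>The function \<open>P(df\<^sub>1, \<dots>, df\<^sub>k)\<close>.\<close>

definition mvf_apply :: "'a::real_normed_vector mvf \<Rightarrow> ('a \<Rightarrow> real) list \<Rightarrow> 'a \<Rightarrow> real" where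
  "mvf_apply P fs p = P p (map (\<lambda>f. differential f p) fs)"

text \<open>Permutations of \<open>0, \<dots>, p + q - 1\<close> with \<open>\<sigma> 0 < \<dots> < \<sigma> (p - 1)\<close> and \<open>\<sigma> p < \<dots> < \<sigma> (p + q - 1)\<close>.\<close>

definition unshuffles :: "nat \<Rightarrow> nat \<Rightarrow> (nat \<Rightarrow> nat) set" where
  "unshuffles p q = {\<sigma>. \<sigma> permutes {..<p + q} \<and> strict_mono_on {..<p} \<sigma> \<and> strict_mono_on {p..<p + q} \<sigma>}"

text \<open>
  The Schouten bracket of a \<open>p\<close>-vector field and a \<open>q\<close>-vector field (\<open>p, q \<ge> 1\<close>), with the convention
  \<open>[X\<^sub>1 \<and> \<dots> \<and> X\<^sub>p, Y\<^sub>1 \<and> \<dots> \<and> Y\<^sub>q] = \<Sum>\<^sub>i\<^sub>j (-1)\<^sup>i\<^sup>+\<^sup>j [X\<^sub>i, Y\<^sub>j] \<and> X\<^sub>1 \<and> \<dots> (no X\<^sub>i) \<dots> \<and> X\<^sub>p \<and> Y\<^sub>1 \<and> \<dots> (no Y\<^sub>j) \<dots> \<and> Y\<^sub>q\<close>.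
  It is written in terms of multiderivations of functions and evaluated at linear functions,
  whose differentials are the given covectors. In particular
  \<open>1/2 [\<pi>, \<pi>](df, dg, dh) = {f, {g, h}} + c.p.\<close> where \<open>{f, g} = \<pi>(df, dg)\<close>; the opposite sign is also
  in use elsewhere.
\<close>

definition schouten :: "nat \<Rightarrow> nat \<Rightarrow> 'a::real_normed_vector mvf \<Rightarrow> 'a mvf \<Rightarrow> 'a mvf" where
  "schouten p q P Q v \<theta>s =
     (if length \<theta>s = p + q - 1 then
        (-1) ^ ((p - 1) * (q - 1)) *
          (\<Sum>\<sigma>\<in>unshuffles q (p - 1).
             let fs = permute_list \<sigma> (map blinfun_apply \<theta>s)
             in of_int (sign \<sigma>) * mvf_apply P (mvf_apply Q (take q fs) # drop q fs) v)
        - (\<Sum>\<sigma>\<in>unshuffles p (q - 1).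
             let fs = permute_list \<sigma> (map blinfun_apply \<theta>s)
             in of_int (sign \<sigma>) * mvf_apply Q (mvf_apply P (take p fs) # drop p fs) v)
      else 0)"

abbreviation lie_derivative :: "('a \<Rightarrow> 'a) \<Rightarrow> nat \<Rightarrow> 'a::real_normed_vector mvf \<Rightarrow> 'a mvf" where
  "lie_derivative X k P \<equiv> schouten 1 k (vector_field_mvf X) P"

definition lie_bracket :: "('a \<Rightarrow> 'a) \<Rightarrow> ('a \<Rightarrow> 'a) \<Rightarrow> 'a::real_normed_vector \<Rightarrow> 'a" where
  "lie_bracket X Y p = frechet_derivative Y (at p) (X p) - frechet_derivative X (at p) (Y p)"


section \<open>Lie groupoids and multiplicative bivector fields\<close>

text \<open>
  Groupoids with space of arrows \<open>'g\<close> and space of objects \<open>'b\<close>. The product \<open>mult \<Gamma> g h\<close> is only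
  meaningful if \<open>tgt \<Gamma> g = src \<Gamma> h\<close>.
\<close>

record ('b, 'g) groupoid =
  src :: "'g \<Rightarrow> 'b"
  tgt :: "'g \<Rightarrow> 'b"
  unit :: "'b \<Rightarrow> 'g"
  mult :: "'g \<Rightarrow> 'g \<Rightarrow> 'g"

text \<open>
  Smoothness of the product on the closed submanifold of composable pairs means that it has a
  smooth extension to \<open>'g \<times> 'g\<close>.
\<close>

definition lie_groupoid :: "('b::real_normed_vector, 'g::real_normed_vector) groupoid \<Rightarrow> bool" where
  "lie_groupoid \<Gamma> \<longleftrightarrow>
     (\<forall>a. src \<Gamma> (unit \<Gamma> a) = a \<and> tgt \<Gamma> (unit \<Gamma> a) = a) \<and>
     (\<forall>g h. tgt \<Gamma> g = src \<Gamma> h \<longrightarrow>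
        src \<Gamma> (mult \<Gamma> g h) = src \<Gamma> g \<and> tgt \<Gamma> (mult \<Gamma> g h) = tgt \<Gamma> h) \<and>
     (\<forall>g h k. tgt \<Gamma> g = src \<Gamma> h \<and> tgt \<Gamma> h = src \<Gamma> k \<longrightarrow>
        mult \<Gamma> (mult \<Gamma> g h) k = mult \<Gamma> g (mult \<Gamma> h k)) \<and>
     (\<forall>g. mult \<Gamma> (unit \<Gamma> (src \<Gamma> g)) g = g \<and> mult \<Gamma> g (unit \<Gamma> (tgt \<Gamma> g)) = g) \<and>
     (\<exists>i. smooth i \<and> (\<forall>g. src \<Gamma> (i g) = tgt \<Gamma> g \<and> tgt \<Gamma> (i g) = src \<Gamma> g \<and>
        mult \<Gamma> g (i g) = unit \<Gamma> (src \<Gamma> g) \<and> mult \<Gamma> (i g) g = unit \<Gamma> (tgt \<Gamma> g))) \<and>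
     smooth (src \<Gamma>) \<and> smooth (tgt \<Gamma>) \<and> smooth (unit \<Gamma>) \<and>
     (\<forall>g. surj (frechet_derivative (src \<Gamma>) (at g)) \<and> surj (frechet_derivative (tgt \<Gamma>) (at g))) \<and>
     (\<exists>F. smooth F \<and> (\<forall>g h. tgt \<Gamma> g = src \<Gamma> h \<longrightarrow> F (g, h) = mult \<Gamma> g h))"

definition mult_graph :: "('b, 'g) groupoid \<Rightarrow> ('g \<times> 'g \<times> 'g) set" where
  "mult_graph \<Gamma> = {(g, h, mult \<Gamma> g h) | g h. tgt \<Gamma> g = src \<Gamma> h}"

definition tangent_vectors :: "'a::real_normed_vector set \<Rightarrow> 'a \<Rightarrow> 'a set" where
  "tangent_vectors S p =
     {v. \<exists>\<gamma> :: real \<Rightarrow> 'a. smooth \<gamma> \<and> range \<gamma> \<subseteq> S \<and> \<gamma> 0 = p \<and> (\<gamma> has_vector_derivative v) (at 0)}"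

definition conormal_covectors :: "'a::real_normed_vector set \<Rightarrow> 'a \<Rightarrow> ('a \<Rightarrow>\<^sub>L real) set" where
  "conormal_covectors S p = {\<theta>. \<forall>v\<in>tangent_vectors S p. blinfun_apply \<theta> v = 0}"

definition coisotropic :: "'a::real_normed_vector mvf \<Rightarrow> 'a set \<Rightarrow> bool" where
  "coisotropic \<pi> S \<longleftrightarrow>
     (\<forall>p\<in>S. \<forall>\<theta>\<in>conormal_covectors S p. \<forall>\<eta>\<in>conormal_covectors S p. \<pi> p [\<theta>, \<eta>] = 0)"

text \<open>\<open>\<pi> \<oplus> \<pi> \<oplus> (-\<pi>)\<close> on the threefold product.\<close>

definition triple_bivector :: "'g::real_normed_vector mvf \<Rightarrow> ('g \<times> 'g \<times> 'g) mvf" where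
  "triple_bivector \<pi> = (\<lambda>(g, h, k) \<theta>s.
       \<pi> g (map (\<lambda>\<theta>. \<theta> o\<^sub>L Blinfun (\<lambda>X. (X, 0, 0))) \<theta>s)
     + \<pi> h (map (\<lambda>\<theta>. \<theta> o\<^sub>L Blinfun (\<lambda>X. (0, X, 0))) \<theta>s)
     - \<pi> k (map (\<lambda>\<theta>. \<theta> o\<^sub>L Blinfun (\<lambda>X. (0, 0, X))) \<theta>s))"

definition multiplicative ::
  "('b, 'g::real_normed_vector) groupoid \<Rightarrow> 'g mvf \<Rightarrow> bool" where
  "multiplicative \<Gamma> \<pi> \<longleftrightarrow> coisotropic (triple_bivector \<pi>) (mult_graph \<Gamma>)"


section \<open>2-term \<open>L\<^sub>\<infinity>\<close>-algebras\<close>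

text \<open>
  The spaces \<open>\<gg>\<^sub>-\<^sub>1\<close> and \<open>\<gg>\<^sub>0\<close> are the types \<open>'m\<close> and \<open>'x\<close>. The value \<open>l\<^sub>2(m, x)\<close> is always written as
  \<open>- l21 x m\<close>.
\<close>

locale two_term_L_infinity =
  fixes l1 :: "'m::real_vector \<Rightarrow> 'x::real_vector"
    and l20 :: "'x \<Rightarrow> 'x \<Rightarrow> 'x"
    and l21 :: "'x \<Rightarrow> 'm \<Rightarrow> 'm"
    and l3 :: "'x \<Rightarrow> 'x \<Rightarrow> 'x \<Rightarrow> 'm"
  assumes linear_l1: "linear l1"
    and linear_l20: "linear (\<lambda>x. l20 x y)" "linear (\<lambda>y. l20 x y)"
    and linear_l21: "linear (\<lambda>x. l21 x m)" "linear (\<lambda>m. l21 x m)"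
    and linear_l3: "linear (\<lambda>x. l3 x y z)" "linear (\<lambda>y. l3 x y z)" "linear (\<lambda>z. l3 x y z)"
    and skew_l20: "l20 y x = - l20 x y"
    and skew_l3: "l3 y x z = - l3 x y z" "l3 x z y = - l3 x y z"
    and l1_l21: "l1 (l21 x m) = l20 x (l1 m)"
    and l21_l1: "l21 (l1 m) n = - l21 (l1 n) m"
    and jacobi_0: "l20 (l20 x y) z + l20 (l20 y z) x + l20 (l20 z x) y + l1 (l3 x y z) = 0"
    and jacobi_1: "l21 (l20 x y) m + (- l21 x (l21 y m)) + (- l21 y (- l21 x m)) + l3 x y (l1 m) = 0"
    and coherence:
      "(\<Sum>\<sigma>\<in>unshuffles 2 2. of_int (sign \<sigma>) *\<^sub>R
          l3 (l20 (w (\<sigma> 0)) (w (\<sigma> 1))) (w (\<sigma> 2)) (w (\<sigma> 3)))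
       = (\<Sum>\<tau>\<in>unshuffles 3 1. of_int (sign \<tau>) *\<^sub>R
          (- l21 (w (\<tau> 3)) (l3 (w (\<tau> 0)) (w (\<tau> 1)) (w (\<tau> 2)))))"

definition l1_dual :: "('m::real_normed_vector \<Rightarrow> 'x::real_normed_vector) \<Rightarrow> ('x \<Rightarrow>\<^sub>L real) \<Rightarrow> 'm \<Rightarrow>\<^sub>L real" where
  "l1_dual l1 \<xi> = Blinfun (\<lambda>m. - blinfun_apply \<xi> (l1 m))"


section \<open>The Lie quasi-bialgebroid \<open>(A, \<delta>, \<phi>)\<close>\<close>

text \<open>
  Sections of \<open>A\<close> are smooth maps \<open>\<gg>\<^sub>-\<^sub>1\<^sup>* \<rightarrow> \<gg>\<^sub>0\<^sup>*\<close>, sections of \<open>A\<^sup>*\<close> are smooth maps \<open>\<gg>\<^sub>-\<^sub>1\<^sup>* \<rightarrow> \<gg>\<^sub>0\<close>, and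
  sections of \<open>\<And>\<^sup>k A\<close> are smooth fields of \<open>k\<close>-forms on \<open>\<gg>\<^sub>0\<close>. The brackets of constant sections and
  the Leibniz rule lead to the derivative terms in the two brackets below.
\<close>

definition anchor_A ::
  "('m::real_normed_vector \<Rightarrow> 'x::real_normed_vector) \<Rightarrow> ('x \<Rightarrow>\<^sub>L real) \<Rightarrow> 'm \<Rightarrow>\<^sub>L real" where
  "anchor_A l1 \<xi> = - l1_dual l1 \<xi>"

definition bracket_A ::
  "('m::real_normed_vector \<Rightarrow> 'x::real_normed_vector) \<Rightarrow> (('m \<Rightarrow>\<^sub>L real) \<Rightarrow> ('x \<Rightarrow>\<^sub>L real)) \<Rightarrow>
   (('m \<Rightarrow>\<^sub>L real) \<Rightarrow> ('x \<Rightarrow>\<^sub>L real)) \<Rightarrow> ('m \<Rightarrow>\<^sub>L real) \<Rightarrow> ('x \<Rightarrow>\<^sub>L real)" where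
  "bracket_A l1 e e' \<alpha> =
     frechet_derivative e' (at \<alpha>) (anchor_A l1 (e \<alpha>)) - frechet_derivative e (at \<alpha>) (anchor_A l1 (e' \<alpha>))"

text \<open>
  The vector field \<open>\<rho>\<^bsub>A\<^sup>*\<^esub>(x)\<close> at \<open>\<alpha> \<in> \<gg>\<^sub>-\<^sub>1\<^sup>*\<close>; its derivative of the linear function \<open>m\<close> is \<open>\<langle>\<alpha>, l\<^sub>2(x, m)\<rangle>\<close>.
\<close>

definition anchor_Adual ::
  "('x \<Rightarrow> 'm \<Rightarrow> 'm) \<Rightarrow> ('m::real_normed_vector \<Rightarrow>\<^sub>L real) \<Rightarrow> 'x \<Rightarrow> 'm \<Rightarrow>\<^sub>L real" where
  "anchor_Adual l21 \<alpha> x = Blinfun (\<lambda>m. blinfun_apply \<alpha> (l21 x m))"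

definition bracket_Adual ::
  "('x \<Rightarrow> 'x \<Rightarrow> 'x) \<Rightarrow> ('x \<Rightarrow> 'm \<Rightarrow> 'm) \<Rightarrow> (('m::real_normed_vector \<Rightarrow>\<^sub>L real) \<Rightarrow> 'x::real_normed_vector) \<Rightarrow>
   (('m \<Rightarrow>\<^sub>L real) \<Rightarrow> 'x) \<Rightarrow> ('m \<Rightarrow>\<^sub>L real) \<Rightarrow> 'x" where
  "bracket_Adual l20 l21 u v \<alpha> =
     l20 (u \<alpha>) (v \<alpha>)
     + frechet_derivative v (at \<alpha>) (anchor_Adual l21 \<alpha> (u \<alpha>))
     - frechet_derivative u (at \<alpha>) (anchor_Adual l21 \<alpha> (v \<alpha>))"

text \<open>
  The operator \<open>\<delta>\<close> on functions and on sections of \<open>A\<close>; as a derivation it is determined by these.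
\<close>

definition delta_fun ::
  "('x::real_normed_vector \<Rightarrow> 'm \<Rightarrow> 'm) \<Rightarrow> (('m::real_normed_vector \<Rightarrow>\<^sub>L real) \<Rightarrow> real) \<Rightarrow>
   ('m \<Rightarrow>\<^sub>L real) \<Rightarrow> ('x \<Rightarrow>\<^sub>L real)" where
  "delta_fun l21 f \<alpha> = Blinfun (\<lambda>x. frechet_derivative f (at \<alpha>) (anchor_Adual l21 \<alpha> x))"

definition delta_formula ::
  "('x \<Rightarrow> 'x \<Rightarrow> 'x) \<Rightarrow> ('x \<Rightarrow> 'm \<Rightarrow> 'm) \<Rightarrow>
   (('m::real_normed_vector \<Rightarrow>\<^sub>L real) \<Rightarrow> ('x::real_normed_vector \<Rightarrow>\<^sub>L real)) \<Rightarrow>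
   (('m \<Rightarrow>\<^sub>L real) \<Rightarrow> 'x) \<Rightarrow> (('m \<Rightarrow>\<^sub>L real) \<Rightarrow> 'x) \<Rightarrow> ('m \<Rightarrow>\<^sub>L real) \<Rightarrow> real" where
  "delta_formula l20 l21 e u v \<alpha> =
     frechet_derivative (\<lambda>\<beta>. blinfun_apply (e \<beta>) (v \<beta>)) (at \<alpha>) (anchor_Adual l21 \<alpha> (u \<alpha>))
     - frechet_derivative (\<lambda>\<beta>. blinfun_apply (e \<beta>) (u \<beta>)) (at \<alpha>) (anchor_Adual l21 \<alpha> (v \<alpha>))
     - blinfun_apply (e \<alpha>) (bracket_Adual l20 l21 u v \<alpha>)"

text \<open>
  The value of \<open>\<delta>e\<close> on two elements of a fibre of \<open>A\<^sup>*\<close> is read off from their constant extensions;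
  the lemma \<open>delta_sec_apply\<close> shows that arbitrary sections give the same value.
\<close>

definition delta_sec ::
  "('x \<Rightarrow> 'x \<Rightarrow> 'x) \<Rightarrow> ('x \<Rightarrow> 'm \<Rightarrow> 'm) \<Rightarrow>
   (('m::real_normed_vector \<Rightarrow>\<^sub>L real) \<Rightarrow> ('x::real_normed_vector \<Rightarrow>\<^sub>L real)) \<Rightarrow>
   ('m \<Rightarrow>\<^sub>L real) \<Rightarrow> 'x list \<Rightarrow> real" where
  "delta_sec l20 l21 e \<alpha> xs =
     (if length xs = 2 then delta_formula l20 l21 e (\<lambda>_. xs ! 0) (\<lambda>_. xs ! 1) \<alpha> else 0)"

definition phi :: "('x \<Rightarrow> 'x \<Rightarrow> 'x \<Rightarrow> 'm) \<Rightarrow> ('m::real_normed_vector \<Rightarrow>\<^sub>L real) \<Rightarrow> 'x list \<Rightarrow> real" where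
  "phi l3 \<alpha> xs = (if length xs = 3 then - blinfun_apply \<alpha> (l3 (xs ! 0) (xs ! 1) (xs ! 2)) else 0)"

lemma frechet_derivative_pairing:
  fixes e :: "'a::real_normed_vector \<Rightarrow> ('x::real_normed_vector \<Rightarrow>\<^sub>L real)"
  assumes "e differentiable (at \<alpha>)" "u differentiable (at \<alpha>)"
  shows "frechet_derivative (\<lambda>\<beta>. blinfun_apply (e \<beta>) (u \<beta>)) (at \<alpha>) w
    = blinfun_apply (e \<alpha>) (frechet_derivative u (at \<alpha>) w)
      + blinfun_apply (frechet_derivative e (at \<alpha>) w) (u \<alpha>)"
proof -
  have "((\<lambda>\<beta>. blinfun_apply (e \<beta>) (u \<beta>)) has_derivative
      (\<lambda>w. blinfun_apply (e \<alpha>) (frechet_derivative u (at \<alpha>) w)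
      + blinfun_apply (frechet_derivative e (at \<alpha>) w) (u \<alpha>))) (at \<alpha>)"
    by (rule bounded_bilinear.FDERIV[OF bounded_bilinear_blinfun_apply])
      (simp_all add: assms flip: frechet_derivative_works)
  from frechet_derivative_at[OF this] show ?thesis
    by (simp add: fun_eq_iff)
qed

lemma delta_sec_apply:
  assumes "e differentiable (at \<alpha>)" "u differentiable (at \<alpha>)" "v differentiable (at \<alpha>)"
  shows "delta_sec l20 l21 e \<alpha> [u \<alpha>, v \<alpha>] = delta_formula l20 l21 e u v \<alpha>"
  using assms
  by (simp add: delta_sec_def delta_formula_def bracket_Adual_def frechet_derivative_pairing
      blinfun.add_right blinfun.diff_right)

lemma bracket_Adual_const: "bracket_Adual l20 l21 (\<lambda>_. x) (\<lambda>_. y) = (\<lambda>_. l20 x y)"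
  by (simp add: bracket_Adual_def fun_eq_iff)

lemma bracket_Adual_leibniz:
  assumes "f differentiable (at \<alpha>)" "v differentiable (at \<alpha>)" "linear (l20 (u \<alpha>))"
    and "linear (frechet_derivative u (at \<alpha>))"
    and "anchor_Adual l21 \<alpha> (f \<alpha> *\<^sub>R v \<alpha>) = f \<alpha> *\<^sub>R anchor_Adual l21 \<alpha> (v \<alpha>)"
  shows "bracket_Adual l20 l21 u (\<lambda>\<beta>. f \<beta> *\<^sub>R v \<beta>) \<alpha> =
    f \<alpha> *\<^sub>R bracket_Adual l20 l21 u v \<alpha> + frechet_derivative f (at \<alpha>) (anchor_Adual l21 \<alpha> (u \<alpha>)) *\<^sub>R v \<alpha>"
proof -
  have "((\<lambda>\<beta>. f \<beta> *\<^sub>R v \<beta>) has_derivative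
      (\<lambda>w. f \<alpha> *\<^sub>R frechet_derivative v (at \<alpha>) w + frechet_derivative f (at \<alpha>) w *\<^sub>R v \<alpha>)) (at \<alpha>)"
    by (rule has_derivative_scaleR) (simp_all add: assms flip: frechet_derivative_works)
  from frechet_derivative_at[OF this]
  have "frechet_derivative (\<lambda>\<beta>. f \<beta> *\<^sub>R v \<beta>) (at \<alpha>) w =
      f \<alpha> *\<^sub>R frechet_derivative v (at \<alpha>) w + frechet_derivative f (at \<alpha>) w *\<^sub>R v \<alpha>" for w
    by (simp add: fun_eq_iff)
  then show ?thesis
    using assms by (simp add: bracket_Adual_def linear_scale algebra_simps)
qed


section \<open>The action groupoid and quasi-Poisson structures on it\<close>

type_synonym ('m, 'x) arrows = "('m \<Rightarrow>\<^sub>L real) \<times> ('x \<Rightarrow>\<^sub>L real)"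

definition action_groupoid ::
  "('m::real_normed_vector \<Rightarrow> 'x::real_normed_vector) \<Rightarrow> ('m \<Rightarrow>\<^sub>L real, ('m, 'x) arrows) groupoid" where
  "action_groupoid l1 =
     \<lparr>src = (\<lambda>(\<alpha>, \<xi>). \<alpha>),
      tgt = (\<lambda>(\<alpha>, \<xi>). \<alpha> + l1_dual l1 \<xi>),
      unit = (\<lambda>\<alpha>. (\<alpha>, 0)),
      mult = (\<lambda>(\<alpha>, \<xi>) (\<beta>, \<eta>). (\<alpha>, \<xi> + \<eta>))\<rparr>"

text \<open>Elements of \<open>\<gg>\<^sub>0\<close> and \<open>\<gg>\<^sub>-\<^sub>1\<close> as linear functions on the space of arrows.\<close>

definition lin_0 :: "'x::real_normed_vector \<Rightarrow> ('m::real_normed_vector, 'x) arrows \<Rightarrow> real" where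
  "lin_0 x = (\<lambda>(\<alpha>, \<xi>). blinfun_apply \<xi> x)"

definition lin_1 :: "'m::real_normed_vector \<Rightarrow> ('m, 'x::real_normed_vector) arrows \<Rightarrow> real" where
  "lin_1 m = (\<lambda>(\<alpha>, \<xi>). blinfun_apply \<alpha> m)"

text \<open>The vectors at an arrow obtained by translating \<open>\<eta> \<in> \<gg>\<^sub>0\<^sup>*\<close> from the fibre of \<open>A\<close> over its target
  (left) or its source (right).\<close>

definition left_vector :: "('x \<Rightarrow>\<^sub>L real) \<Rightarrow> ('m::real_normed_vector, 'x::real_normed_vector) arrows" where
  "left_vector \<eta> = (0, \<eta>)"

definition right_vector ::
  "('m \<Rightarrow> 'x) \<Rightarrow> ('x \<Rightarrow>\<^sub>L real) \<Rightarrow> ('m::real_normed_vector, 'x::real_normed_vector) arrows" where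
  "right_vector l1 \<eta> = (- l1_dual l1 \<eta>, \<eta>)"

definition left_field ::
  "('m \<Rightarrow> 'x) \<Rightarrow> (('m \<Rightarrow>\<^sub>L real) \<Rightarrow> ('x \<Rightarrow>\<^sub>L real)) \<Rightarrow>
   ('m::real_normed_vector, 'x::real_normed_vector) arrows \<Rightarrow> ('m, 'x) arrows" where
  "left_field l1 e g = left_vector (e (tgt (action_groupoid l1) g))"

definition right_field ::
  "('m \<Rightarrow> 'x) \<Rightarrow> (('m \<Rightarrow>\<^sub>L real) \<Rightarrow> ('x \<Rightarrow>\<^sub>L real)) \<Rightarrow>
   ('m::real_normed_vector, 'x::real_normed_vector) arrows \<Rightarrow> ('m, 'x) arrows" where
  "right_field l1 e g = right_vector l1 (e (src (action_groupoid l1) g))"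

text \<open>The element of \<open>\<gg>\<^sub>0\<close> representing a linear form on \<open>\<gg>\<^sub>0\<^sup>*\<close>.\<close>

definition from_bidual :: "(('x::real_normed_vector \<Rightarrow>\<^sub>L real) \<Rightarrow> real) \<Rightarrow> 'x" where
  "from_bidual F = (THE x. \<forall>\<eta>. blinfun_apply \<eta> x = F \<eta>)"

text \<open>Translations of sections of \<open>\<And>\<^sup>k A\<close>: push-forward along \<open>left_vector\<close> and \<open>right_vector\<close>, which is
  pull-back of covectors.\<close>

definition left_mvf ::
  "('m \<Rightarrow> 'x) \<Rightarrow> (('m \<Rightarrow>\<^sub>L real) \<Rightarrow> 'x list \<Rightarrow> real) \<Rightarrow>
   ('m::real_normed_vector, 'x::real_normed_vector) arrows mvf" where
  "left_mvf l1 \<psi> g \<theta>s =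
     \<psi> (tgt (action_groupoid l1) g)
       (map (\<lambda>\<theta>. from_bidual (\<lambda>\<eta>. blinfun_apply \<theta> (left_vector \<eta>))) \<theta>s)"

definition right_mvf ::
  "('m \<Rightarrow> 'x) \<Rightarrow> (('m \<Rightarrow>\<^sub>L real) \<Rightarrow> 'x list \<Rightarrow> real) \<Rightarrow>
   ('m::real_normed_vector, 'x::real_normed_vector) arrows mvf" where
  "right_mvf l1 \<psi> g \<theta>s =
     \<psi> (src (action_groupoid l1) g)
       (map (\<lambda>\<theta>. from_bidual (\<lambda>\<eta>. blinfun_apply \<theta> (right_vector l1 \<eta>))) \<theta>s)"

text \<open>
  \<open>A\<close> is the Lie algebroid of the action groupoid: right translation identifies \<open>A\<close> with the kernel
  of the differential of the target map along the units, and the anchor and the bracket of \<open>A\<close> are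
  induced by the source map and the bracket of right translations. This is the convention that fits
  \<open>\<rho>\<^sub>A = - l\<^sub>1\<^sup>*\<close>.
\<close>

definition integrates_A :: "('m::real_normed_vector \<Rightarrow> 'x::real_normed_vector) \<Rightarrow> bool" where
  "integrates_A l1 \<longleftrightarrow>
     (\<forall>\<alpha>. bij_betw (right_vector l1) UNIV
        {v. frechet_derivative (tgt (action_groupoid l1)) (at (unit (action_groupoid l1) \<alpha>)) v = 0}) \<and>
     (\<forall>e g. frechet_derivative (src (action_groupoid l1)) (at g) (right_field l1 e g)
        = anchor_A l1 (e (src (action_groupoid l1) g))) \<and>
     (\<forall>e e'. smooth e \<and> smooth e' \<longrightarrow>
        lie_bracket (right_field l1 e) (right_field l1 e') = right_field l1 (bracket_A l1 e e'))"

definition quasi_poisson_groupoid ::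
  "('m::real_normed_vector \<Rightarrow> 'x::real_normed_vector) \<Rightarrow> ('m, 'x) arrows mvf \<Rightarrow>
   (('m \<Rightarrow>\<^sub>L real) \<Rightarrow> 'x list \<Rightarrow> real) \<Rightarrow> bool" where
  "quasi_poisson_groupoid l1 \<pi> \<phi> \<longleftrightarrow>
     lie_groupoid (action_groupoid l1) \<and> integrates_A l1 \<and>
     multivector_field 2 \<pi> \<and> multiplicative (action_groupoid l1) \<pi> \<and> wedge_section 3 \<phi> \<and>
     (\<forall>g \<theta>s. 1 / 2 * schouten 2 2 \<pi> \<pi> g \<theta>s = left_mvf l1 \<phi> g \<theta>s - right_mvf l1 \<phi> g \<theta>s) \<and>
     (\<forall>g \<theta>s. schouten 2 3 \<pi> (left_mvf l1 \<phi>) g \<theta>s = 0)"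

text \<open>
  \<open>\<delta>\<^bsub>\<pi>\<^esub>\<close> is given on functions by \<open>d0\<close> and on sections of \<open>A\<close> by \<open>d1\<close>. As left translation is injective,
  the two equations determine \<open>d0\<close> and \<open>d1\<close> on smooth arguments.
\<close>

definition delta_Pi_is ::
  "('m::real_normed_vector \<Rightarrow> 'x::real_normed_vector) \<Rightarrow> ('m, 'x) arrows mvf \<Rightarrow>
   ((('m \<Rightarrow>\<^sub>L real) \<Rightarrow> real) \<Rightarrow> ('m \<Rightarrow>\<^sub>L real) \<Rightarrow> ('x \<Rightarrow>\<^sub>L real)) \<Rightarrow>
   ((('m \<Rightarrow>\<^sub>L real) \<Rightarrow> ('x \<Rightarrow>\<^sub>L real)) \<Rightarrow> ('m \<Rightarrow>\<^sub>L real) \<Rightarrow> 'x list \<Rightarrow> real) \<Rightarrow> bool" where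
  "delta_Pi_is l1 \<pi> d0 d1 \<longleftrightarrow>
     (\<forall>f. smooth f \<longrightarrow> (\<forall>g \<theta>. blinfun_apply \<theta> (left_field l1 (d0 f) g)
        = \<pi> g [differential (\<lambda>h. f (tgt (action_groupoid l1) h)) g, \<theta>])) \<and>
     (\<forall>e. smooth e \<longrightarrow> left_mvf l1 (d1 e) = lie_derivative (left_field l1 e) 2 \<pi>)"

end

theory Submission
  imports Defs
begin

text \<open>
  Because both spaces are finite-dimensional, a covector on the space of arrows is the linear function
  \<open>(\<alpha>, \<xi>) \<mapsto> \<langle>\<alpha>, m\<rangle> + \<langle>\<xi>, x\<rangle>\<close> of a unique pair \<open>(m, x)\<close>, so a bivector field whose values on these
  are again linear functions is a skew bracket on such pairs. The axioms of a 2-term \<open>L\<^sub>\<infinity>\<close>-algebra then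
  turn into the conditions on \<open>\<Pi>\<close>: the compatibilities of \<open>l\<^sub>1\<close> and \<open>l\<^sub>2\<close> into multiplicativity, the Jacobi identities up
  to \<open>l\<^sub>3\<close> into \<open>1/2 [\<Pi>, \<Pi>] = left \<phi> - right \<phi>\<close>, and the coherence law into \<open>[\<Pi>, left \<phi>] = 0\<close>.
  For uniqueness, let \<open>D\<close> be the difference of two solutions. The condition on functions says that \<open>D\<close>
  kills the differentials of \<open>t\<^sup>*f\<close>, and multiplicativity that it vanishes on pairs of covectors
  \<open>(0, x)\<close> at the units; hence \<open>D\<close> vanishes at the units. The condition on constant sections says that
  \<open>D\<close> does not depend on \<open>\<xi>\<close>.
\<close>

section \<open>Finite-dimensional normed spaces\<close>

text \<open>Induction on \<open>B\<close>. The bound for \<open>B\<close> makes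
  \<open>span B\<close> closed, so \<open>a\<close> keeps a positive distance from it, and this
  distance controls the coefficient of \<open>a\<close>.\<close>

lemma coordinates_bound:
  fixes B :: "'a::real_normed_vector set"
  assumes "finite B" "independent B"
  shows "\<exists>C>0. \<forall>c. (\<Sum>b\<in>B. \<bar>c b\<bar>) \<le> C * norm (\<Sum>b\<in>B. c b *\<^sub>R b)"
  using assms
proof (induction B rule: finite_induct)
  case empty
  then show ?case by (intro exI[of _ 1]) auto
next
  case (insert a B)
  then have indep: "independent B" and a: "a \<notin> span B"
    by (auto simp: independent_insert)
  with insert.IH obtain C where "C > 0" and C: "\<And>c. (\<Sum>b\<in>B. \<bar>c b\<bar>) \<le> C * norm (\<Sum>b\<in>B. c b *\<^sub>R b)"
    by blast
  have rep_sum: "(\<Sum>b\<in>B. representation B v b *\<^sub>R b) = v" if "v \<in> span B" for v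
    using sum_representation_eq[OF indep that] insert.hyps by simp
  \<comment> \<open>By the bound for \<open>B\<close>, the coordinates of a convergent sequence in
    \<open>span B\<close> are Cauchy; their limits are the coordinates of its limit.\<close>
  have "closed (span B)"
    unfolding closed_sequential_limits
  proof (intro allI impI, elim conjE)
    fix v l assume v: "\<forall>n. v n \<in> span B" and lim: "v \<longlonglongrightarrow> l"
    have "Cauchy (\<lambda>n. representation B (v n) b)" if "b \<in> B" for b
    proof (rule metric_CauchyI)
      fix e :: real assume "e > 0"
      then have "e / C > 0" using \<open>C > 0\<close> by simp
      then obtain N where N: "\<And>m n. m \<ge> N \<Longrightarrow> n \<ge> N \<Longrightarrow> dist (v m) (v n) < e / C"
        using LIMSEQ_imp_Cauchy[OF lim] by (meson metric_CauchyD)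
      show "\<exists>N. \<forall>m\<ge>N. \<forall>n\<ge>N. dist (representation B (v m) b) (representation B (v n) b) < e"
      proof (intro exI allI impI)
        fix m n assume "m \<ge> N" "n \<ge> N"
        have "\<bar>representation B (v m) b - representation B (v n) b\<bar>
            \<le> (\<Sum>b\<in>B. \<bar>representation B (v m) b - representation B (v n) b\<bar>)"
          using that insert.hyps
          by (intro member_le_sum[where f = "\<lambda>b. \<bar>representation B (v m) b - representation B (v n) b\<bar>"]) auto
        also have "\<dots> \<le> C * norm (\<Sum>b\<in>B. (representation B (v m) b - representation B (v n) b) *\<^sub>R b)"
          by (rule C)
        also have "(\<Sum>b\<in>B. (representation B (v m) b - representation B (v n) b) *\<^sub>R b) = v m - v n"
          using v by (simp add: scaleR_left_diff_distrib sum_subtractf rep_sum)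
        also have "C * norm (v m - v n) < e"
          using N[OF \<open>m \<ge> N\<close> \<open>n \<ge> N\<close>] \<open>C > 0\<close> by (simp add: dist_norm pos_less_divide_eq mult.commute)
        finally show "dist (representation B (v m) b) (representation B (v n) b) < e"
          by (simp add: dist_real_def)
      qed
    qed
    then have "(\<lambda>n. representation B (v n) b) \<longlonglongrightarrow> lim (\<lambda>n. representation B (v n) b)" if "b \<in> B" for b
      using that by (simp add: Cauchy_convergent_iff convergent_LIMSEQ_iff)
    then have "(\<lambda>n. \<Sum>b\<in>B. representation B (v n) b *\<^sub>R b)
        \<longlonglongrightarrow> (\<Sum>b\<in>B. lim (\<lambda>n. representation B (v n) b) *\<^sub>R b)"
      by (intro tendsto_intros) auto
    then have "v \<longlonglongrightarrow> (\<Sum>b\<in>B. lim (\<lambda>n. representation B (v n) b) *\<^sub>R b)"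
      using v by (simp add: rep_sum)
    with lim have "l = (\<Sum>b\<in>B. lim (\<lambda>n. representation B (v n) b) *\<^sub>R b)"
      by (rule LIMSEQ_unique)
    then show "l \<in> span B"
      by (auto intro: span_sum span_scale span_base)
  qed
  then obtain d where "d > 0" and "ball a d \<subseteq> - span B"
    using a by (metis open_Compl open_contains_ball ComplI)
  then have d: "d \<le> dist a v" if "v \<in> span B" for v
    using that by (force simp: subset_iff not_less)
  \<comment> \<open>The constant combines two estimates:
    \<open>\<bar>c a\<bar> \<le> norm w / d\<close>, from the distance, and
    \<open>norm v \<le> norm w + \<bar>c a\<bar> * norm a\<close>, which feeds the bound for
    \<open>B\<close>.\<close>
  have "(\<Sum>b\<in>insert a B. \<bar>c b\<bar>) \<le> (C + (C * norm a + 1) / d) * norm (\<Sum>b\<in>insert a B. c b *\<^sub>R b)" for c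
  proof -
    define v where "v = (\<Sum>b\<in>B. c b *\<^sub>R b)"
    define w where "w = c a *\<^sub>R a + v"
    have v: "v \<in> span B"
      by (auto simp: v_def intro: span_sum span_scale span_base)
    have ca: "d * \<bar>c a\<bar> \<le> norm w"
    proof (cases "c a = 0")
      case False
      \<comment> \<open>This point of \<open>span B\<close> has distance
        \<open>norm w / \<bar>c a\<bar>\<close> from \<open>a\<close>.\<close>
      have "- (v /\<^sub>R c a) \<in> span B"
        using v by (intro span_neg span_scale)
      from d[OF this] have "\<bar>c a\<bar> * d \<le> norm (c a *\<^sub>R (a + v /\<^sub>R c a))"
        unfolding norm_scaleR dist_norm by (intro mult_left_mono) auto
      also have "c a *\<^sub>R (a + v /\<^sub>R c a) = w"
        using False by (simp add: w_def scaleR_right_distrib)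
      finally show ?thesis by (simp add: mult.commute)
    qed simp
    then have ca': "\<bar>c a\<bar> \<le> norm w / d"
      using \<open>d > 0\<close> by (simp add: field_simps)
    have "norm v \<le> norm w + \<bar>c a\<bar> * norm a"
      using norm_triangle_ineq4[of w "c a *\<^sub>R a"] by (simp add: w_def)
    then have "C * norm v \<le> C * norm w + C * norm a * \<bar>c a\<bar>"
      using \<open>C > 0\<close> mult_left_mono[of _ _ C] by (fastforce simp: algebra_simps)
    then have "\<bar>c a\<bar> + (\<Sum>b\<in>B. \<bar>c b\<bar>) \<le> C * norm w + (C * norm a + 1) * \<bar>c a\<bar>"
      using C[of c] by (simp add: v_def algebra_simps)
    also have "\<dots> \<le> C * norm w + (C * norm a + 1) * (norm w / d)"
      using ca' \<open>C > 0\<close> by (intro add_left_mono mult_left_mono) auto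
    finally show ?thesis
      using insert.hyps by (simp add: w_def v_def algebra_simps)
  qed
  moreover have "C + (C * norm a + 1) / d > 0"
    using \<open>C > 0\<close> \<open>d > 0\<close> by (simp add: add_pos_nonneg)
  ultimately show ?case by blast
qed

text \<open>Later uses of finite-dimensionality rest on these two facts: expansion in coordinates,
  and continuity of the coordinates, which comes from \<open>coordinates_bound\<close>.\<close>

lemma finite_dim_basis:
  assumes "\<exists>B :: 'a::real_normed_vector set. finite B \<and> span B = UNIV"
  obtains B where "\<And>v :: 'a. (\<Sum>b\<in>B. representation B v b *\<^sub>R b) = v"
    "\<And>b. bounded_linear (\<lambda>v. representation B v b)"
proof -
  obtain S :: "'a set" where S: "finite S" "span S = UNIV" using assms by blast
  obtain B where B: "B \<subseteq> S" "independent B" "S \<subseteq> span B"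
    using maximal_independent_subset[of S] by blast
  have fin: "finite B" using B S finite_subset by blast
  have sp: "span B = UNIV"
    using S B span_mono[OF B(3)] by (simp add: span_span top.extremum_unique)
  have rep: "(\<Sum>b\<in>B. representation B v b *\<^sub>R b) = v" for v
    using sum_representation_eq[OF B(2), of v] sp fin by simp
  obtain C where C: "C > 0" "\<And>c. (\<Sum>b\<in>B. \<bar>c b\<bar>) \<le> C * norm (\<Sum>b\<in>B. c b *\<^sub>R b)"
    using coordinates_bound[OF fin B(2)] by blast
  have bound: "(\<Sum>b\<in>B. \<bar>representation B v b\<bar>) \<le> C * norm v" for v
    using C(2)[of "representation B v"] by (simp add: rep)
  have "bounded_linear (\<lambda>v. representation B v b)" for b
  proof (rule bounded_linear_intro[where K = C])
    show "norm (representation B v b) \<le> norm v * C" for v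
    proof (cases "b \<in> B")
      case True
      then have "\<bar>representation B v b\<bar> \<le> (\<Sum>b\<in>B. \<bar>representation B v b\<bar>)"
        using fin by (intro member_le_sum[where f = "\<lambda>b. \<bar>representation B v b\<bar>"]) auto
      with bound[of v] show ?thesis by (simp add: mult.commute)
    next
      \<comment> \<open>\<open>representation\<close> has the default value 0 outside the
        basis.\<close>
      case False
      then show ?thesis using C(1) representation_ne_zero[of B v b] by force
    qed
  qed (use B(2) sp in \<open>simp_all add: representation_add representation_scale\<close>)
  with rep show ?thesis by (rule that)
qed

text \<open>The map is a sum of continuous coordinates times the fixed vectors \<open>f b\<close>.
  Since \<open>Blinfun\<close> is meaningful only for bounded linear maps, this is what gives the
  \<open>Blinfun\<close> terms of the definitions their intended values.\<close>

lemma bounded_linear_finite_dim: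
  fixes f :: "'a::real_normed_vector \<Rightarrow> 'b::real_normed_vector"
  assumes "\<exists>B :: 'a set. finite B \<and> span B = UNIV" and f: "linear f"
  shows "bounded_linear f"
proof -
  obtain B where rep: "\<And>v :: 'a. (\<Sum>b\<in>B. representation B v b *\<^sub>R b) = v"
    and bl: "\<And>b. bounded_linear (\<lambda>v :: 'a. representation B v b)"
    using finite_dim_basis[OF assms(1)] by metis
  have "f v = (\<Sum>b\<in>B. representation B v b *\<^sub>R f b)" for v
    by (subst (1) rep[symmetric]) (simp add: linear_sum[OF f] linear_scale[OF f])
  then have "f = (\<lambda>v. \<Sum>b\<in>B. representation B v b *\<^sub>R f b)" by (rule ext)
  moreover have "bounded_linear (\<lambda>v. \<Sum>b\<in>B. representation B v b *\<^sub>R f b)"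
    by (intro bounded_linear_sum bounded_linear_scaleR_const bl)
  ultimately show ?thesis by (rule ssubst[where P = bounded_linear])
qed

lemma blinfun_separates_points:
  fixes x y :: "'a::real_normed_vector"
  assumes "\<exists>B :: 'a set. finite B \<and> span B = UNIV"
    and eq: "\<And>\<eta> :: 'a \<Rightarrow>\<^sub>L real. blinfun_apply \<eta> x = blinfun_apply \<eta> y"
  shows "x = y"
proof -
  obtain B where rep: "\<And>v :: 'a. (\<Sum>b\<in>B. representation B v b *\<^sub>R b) = v"
    and bl: "\<And>b. bounded_linear (\<lambda>v :: 'a. representation B v b)"
    using finite_dim_basis[OF assms(1)] by metis
  have "representation B x b = representation B y b" for b
    using eq[of "Blinfun (\<lambda>v. representation B v b)"] by (simp add: bounded_linear_Blinfun_apply bl)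
  then have "(\<Sum>b\<in>B. representation B x b *\<^sub>R b) = (\<Sum>b\<in>B. representation B y b *\<^sub>R b)"
    by (simp only:)
  then show ?thesis by (simp only: rep)
qed

text \<open>Reflexivity: the coordinate functionals form the dual basis, and \<open>F\<close> is
  evaluation at the vector with coordinates \<open>F (coord b)\<close>.\<close>

lemma linear_functional_on_dual:
  fixes F :: "('a::real_normed_vector \<Rightarrow>\<^sub>L real) \<Rightarrow> real"
  assumes "\<exists>B :: 'a set. finite B \<and> span B = UNIV" and F: "linear F"
  obtains x where "\<And>\<eta>. F \<eta> = blinfun_apply \<eta> x"
proof -
  obtain B where rep: "\<And>v :: 'a. (\<Sum>b\<in>B. representation B v b *\<^sub>R b) = v"
    and bl: "\<And>b. bounded_linear (\<lambda>v :: 'a. representation B v b)"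
    using finite_dim_basis[OF assms(1)] by metis
  define coord where "coord b = Blinfun (\<lambda>v. representation B v b)" for b
  have "\<eta> = (\<Sum>b\<in>B. blinfun_apply \<eta> b *\<^sub>R coord b)" for \<eta> :: "'a \<Rightarrow>\<^sub>L real"
  proof (rule blinfun_eqI)
    fix v
    have "blinfun_apply \<eta> v = (\<Sum>b\<in>B. representation B v b * blinfun_apply \<eta> b)"
      by (subst (1) rep[symmetric]) (simp add: blinfun.sum_right blinfun.scaleR_right)
    then show "blinfun_apply \<eta> v = blinfun_apply (\<Sum>b\<in>B. blinfun_apply \<eta> b *\<^sub>R coord b) v"
      by (simp add: blinfun.sum_left blinfun.scaleR_left coord_def bounded_linear_Blinfun_apply bl mult.commute)
  qed
  then have "F \<eta> = F (\<Sum>b\<in>B. blinfun_apply \<eta> b *\<^sub>R coord b)" for \<eta>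
    by (rule arg_cong)
  moreover have "F (\<Sum>b\<in>B. blinfun_apply \<eta> b *\<^sub>R coord b)
      = blinfun_apply \<eta> (\<Sum>b\<in>B. F (coord b) *\<^sub>R b)" for \<eta>
    by (simp add: linear_sum[OF F] linear_scale[OF F] blinfun.sum_right blinfun.scaleR_right mult.commute)
  ultimately show ?thesis
    by (intro that[of "\<Sum>b\<in>B. F (coord b) *\<^sub>R b"]) (rule trans)
qed

text \<open>Separation of points supplies the uniqueness that the description \<open>THE\<close> in
  \<open>from_bidual\<close> requires.\<close>

lemma from_bidual_eq:
  assumes "\<exists>B :: 'a::real_normed_vector set. finite B \<and> span B = UNIV"
    and "\<And>\<eta>. F \<eta> = blinfun_apply \<eta> (x :: 'a)"
  shows "from_bidual F = x"
  unfolding from_bidual_def using assms(2) by (auto intro: blinfun_separates_points[OF assms(1)])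

section \<open>Smoothness of affine maps, and small unshuffles\<close>

lemma frechet_derivative_affine:
  assumes "bounded_linear f"
  shows "frechet_derivative (\<lambda>p. c + f p) (at p) = f"
proof -
  have "((\<lambda>p. c + f p) has_derivative (\<lambda>p. 0 + f p)) (at p)"
    by (intro has_derivative_add has_derivative_const bounded_linear_imp_has_derivative assms)
  from frechet_derivative_at[OF this, symmetric] show ?thesis by simp
qed

lemma frechet_derivative_bounded_linear:
  assumes "bounded_linear f"
  shows "frechet_derivative f (at p) = f"
  using frechet_derivative_affine[OF assms, of 0] by simp

lemma differential_bounded_linear:
  assumes "bounded_linear f"
  shows "differential f p = Blinfun f"
  by (simp add: differential_def frechet_derivative_bounded_linear assms)

lemma differential_blinfun [simp]: "differential (blinfun_apply \<theta>) p = \<theta>"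
  by (simp add: differential_bounded_linear blinfun.bounded_linear_right blinfun_apply_inverse)

lemma differentiable_upto_const: "differentiable_upto k (\<lambda>_. c)"
  by (induction k arbitrary: c) auto

text \<open>Each directional derivative is constant, so the recursion in
  \<open>differentiable_upto\<close> ends after one step. The structure maps of the groupoid and the
  lines used as test curves are of this kind.\<close>

lemma smooth_affine:
  assumes "bounded_linear f"
  shows "smooth (\<lambda>p. c + f p)"
  unfolding smooth_def
proof
  fix k
  show "differentiable_upto k (\<lambda>p. c + f p)"
  proof (cases k)
    case 0
    then show ?thesis
      using assms by (simp add: continuous_on_add linear_continuous_on)
  next
    case (Suc n)
    then show ?thesis
      using assms by (simp add: frechet_derivative_affine differentiable_upto_const
          bounded_linear_imp_differentiable)
  qed
qed

lemma smooth_bounded_linear: "bounded_linear f \<Longrightarrow> smooth f"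
  using smooth_affine[of f 0] by simp

lemma smooth_const: "smooth (\<lambda>_. c)"
  by (simp add: smooth_def differentiable_upto_const)

lemma smooth_imp_differentiable: "smooth f \<Longrightarrow> f differentiable (at p)"
  unfolding smooth_def by (metis differentiable_upto.simps(2))

section \<open>The unshuffles in the Schouten brackets of low degree, with their signs\<close>

lemma unshuffles_2_0: "unshuffles 2 0 = {id}"
proof -
  have "\<sigma> = id" if "\<sigma> permutes {..<2::nat}" "\<sigma> 0 < \<sigma> 1" for \<sigma>
  proof
    fix i
    have "\<sigma> 0 < 2" "\<sigma> 1 < 2" using permutes_in_image[OF that(1)] by auto
    moreover have "\<not> i < 2 \<Longrightarrow> \<sigma> i = i" using permutes_not_in[OF that(1)] by auto
    ultimately show "\<sigma> i = id i" using that(2)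
      by (cases "i = 0"; cases "i = 1") auto
  qed
  then show ?thesis
    by (auto simp: unshuffles_def strict_mono_on_def permutes_id)
qed

lemma unshuffles_1_1: "unshuffles 1 1 = {id, Transposition.transpose 0 1}"
proof -
  have "\<sigma> = id \<or> \<sigma> = Transposition.transpose 0 1" if "\<sigma> permutes {..<Suc (Suc 0)}" for \<sigma>
  proof -
    have "\<sigma> permutes {0, 1}"
      using that by (simp add: lessThan_Suc insert_commute)
    then show ?thesis by (rule permutes_doubleton_iff[THEN iffD1])
  qed
  moreover have "Transposition.transpose 0 (Suc 0) permutes {..<Suc (Suc 0)}"
    by (rule permutes_swap_id) auto
  ultimately show ?thesis
    by (auto simp: unshuffles_def strict_mono_on_def permutes_id)
qed

text \<open>As \<sigma> 0 < \<sigma> 1, an element is determined by \<sigma> 2, whose values 2, 1, 0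
  give the three permutations in the listed order. The 3-cycle is a product of transpositions so
  that its sign can be computed.\<close>

lemma unshuffles_2_1:
  "unshuffles 2 1 = {id, Transposition.transpose 1 2,
     Transposition.transpose 0 1 \<circ> Transposition.transpose 1 2}" (is "_ = {id, ?s, ?c}")
proof (intro equalityI subsetI)
  fix \<sigma> assume \<sigma>: "\<sigma> \<in> unshuffles 2 1"
  then have perm: "\<sigma> permutes {..<3}" and less: "\<sigma> 0 < \<sigma> 1"
    by (auto simp: unshuffles_def strict_mono_on_def)
  have lt: "\<sigma> 0 < 3" "\<sigma> 1 < 3" "\<sigma> 2 < 3" using permutes_in_image[OF perm] by auto
  have neq: "\<sigma> 0 \<noteq> \<sigma> 2" "\<sigma> 1 \<noteq> \<sigma> 2" using permutes_inj[OF perm] by (simp_all add: inj_eq)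
  have out: "\<sigma> i = i" if "i > 2" for i using permutes_not_in[OF perm, of i] that by auto
  have ext: "\<sigma> = \<tau>" if "\<sigma> 0 = \<tau> 0" "\<sigma> 1 = \<tau> 1" "\<sigma> 2 = \<tau> 2" "\<And>i. i > 2 \<Longrightarrow> \<tau> i = i" for \<tau>
  proof
    fix i :: nat
    show "\<sigma> i = \<tau> i"
    proof (cases "i > 2")
      case False
      then have "i = 0 \<or> i = 1 \<or> i = 2" by auto
      then show ?thesis using that by blast
    qed (simp add: out that)
  qed
  have "\<sigma> 0 = 0 \<or> \<sigma> 0 = 1" "\<sigma> 1 = 1 \<or> \<sigma> 1 = 2" "\<sigma> 2 = 0 \<or> \<sigma> 2 = 1 \<or> \<sigma> 2 = 2"
    using lt less by linarith+
  then have "(\<sigma> 0 = 0 \<and> \<sigma> 1 = 1 \<and> \<sigma> 2 = 2) \<or> (\<sigma> 0 = 0 \<and> \<sigma> 1 = 2 \<and> \<sigma> 2 = 1) \<or> (\<sigma> 0 = 1 \<and> \<sigma> 1 = 2 \<and> \<sigma> 2 = 0)"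
    using less neq by fastforce
  then show "\<sigma> \<in> {id, ?s, ?c}"
    using ext[of id] ext[of ?s] ext[of ?c] by (auto simp: transpose_def)
next
  fix \<sigma> assume \<sigma>: "\<sigma> \<in> {id, ?s, ?c}"
  have "?s permutes {..<3}" "Transposition.transpose 0 (1::nat) permutes {..<3}"
    by (rule permutes_swap_id; simp)+
  then have "\<sigma> permutes {..<3}"
    using \<sigma> by (auto simp: permutes_id intro: permutes_compose)
  then show "\<sigma> \<in> unshuffles 2 1"
    using \<sigma> by (auto simp: unshuffles_def strict_mono_on_def less_2_cases_iff)
qed

lemma sum_unshuffles_1_1:
  "(\<Sum>\<sigma>\<in>unshuffles 1 1. of_int (sign \<sigma>) * h \<sigma>) = h id - (h (Transposition.transpose 0 1) :: real)"
proof -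
  have "id \<noteq> Transposition.transpose (0::nat) 1" by (metis id_apply transpose_apply_first zero_neq_one)
  then show ?thesis
    by (simp only: unshuffles_1_1) (simp add: sign_swap_id sign_id)
qed

lemma sum_unshuffles_2_1:
  "(\<Sum>\<sigma>\<in>unshuffles 2 1. of_int (sign \<sigma>) * h \<sigma>) =
     h id - h (Transposition.transpose 1 2) +
     (h (Transposition.transpose 0 1 \<circ> Transposition.transpose 1 2) :: real)"
proof -
  let ?s = "Transposition.transpose 1 2 :: nat \<Rightarrow> nat"
  let ?c = "Transposition.transpose 0 1 \<circ> ?s :: nat \<Rightarrow> nat"
  have "id \<noteq> ?s"
    by (auto dest!: fun_cong[where x = 1] simp: transpose_def)
  moreover have "id \<noteq> ?c" "?s \<noteq> ?c"
    by (auto dest!: fun_cong[where x = 0] simp: transpose_def)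
  moreover have "sign ?c = 1"
    by (subst sign_compose) (auto simp: sign_swap_id permutation_swap_id)
  moreover have "sign ?s = -1"
    by (subst sign_swap_id) auto
  ultimately show ?thesis
    by (simp only: unshuffles_2_1) (simp add: sign_id)
qed


section \<open>Covectors on the space of arrows\<close>

text \<open>\<open>alternating_form\<close> demands vanishing on repeated entries; skewness follows
  by expanding the value on \<open>[a + b, a + b]\<close>.\<close>

lemma alternating_form_2:
  assumes "alternating_form 2 \<omega>"
  shows "linear (\<lambda>a. \<omega> [a, b])" "linear (\<lambda>b. \<omega> [a, b])" "\<omega> [b, a] = - \<omega> [a, b]"
proof -
  have lin: "linear (\<lambda>u. \<omega> (us[i := u]))" if "length us = 2" "i < 2" for us i
    using assms that by (simp add: alternating_form_def)
  \<comment> \<open>The entry \<open>undefined\<close> is a placeholder that the list update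
    overwrites.\<close>
  have lin1: "linear (\<lambda>a. \<omega> [a, b])" for b
    using lin[of "[undefined, b]" 0] by simp
  have lin2: "linear (\<lambda>b. \<omega> [a, b])" for a
    using lin[of "[a, undefined]" 1] by simp
  have "\<forall>us. length us = 2 \<longrightarrow> (\<forall>i<2. \<forall>j<2. i \<noteq> j \<and> us ! i = us ! j \<longrightarrow> \<omega> us = 0)"
    using assms unfolding alternating_form_def by blast
  then have diag: "\<omega> [c, c] = 0" for c
    by (metis One_nat_def length_Cons list.size(3) nth_Cons_0 nth_Cons_Suc numeral_2_eq_2 lessI zero_less_Suc zero_neq_one)
  show "\<omega> [b, a] = - \<omega> [a, b]"
    using diag[of "a + b"] diag[of a] diag[of b]
    by (simp add: linear_add[OF lin1] linear_add[OF lin2])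
  show "linear (\<lambda>a. \<omega> [a, b])" "linear (\<lambda>b. \<omega> [a, b])" by (fact lin1 lin2)+
qed

definition covec ::
  "'m::real_normed_vector \<Rightarrow> 'x::real_normed_vector \<Rightarrow> ('m, 'x) arrows \<Rightarrow>\<^sub>L real" where
  "covec m x = Blinfun (\<lambda>g. blinfun_apply (fst g) m + blinfun_apply (snd g) x)"

lemma covec_apply:
  fixes m :: "'m::real_normed_vector" and x :: "'x::real_normed_vector"
  shows "blinfun_apply (covec m x) g = blinfun_apply (fst g) m + blinfun_apply (snd g) x"
proof -
  have "bounded_linear (\<lambda>g :: ('m, 'x) arrows. blinfun_apply (fst g) m + blinfun_apply (snd g) x)"
    by (intro bounded_linear_intros bounded_linear_fst_comp bounded_linear_snd_comp
        bounded_linear_compose[OF blinfun.bounded_linear_left bounded_linear_fst]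
        bounded_linear_compose[OF blinfun.bounded_linear_left bounded_linear_snd])
  then show ?thesis by (simp add: covec_def bounded_linear_Blinfun_apply)
qed

lemma covec_add: "covec (m + n) (x + y) = covec m x + covec n y"
  and covec_scaleR: "covec (c *\<^sub>R m) (c *\<^sub>R x) = c *\<^sub>R covec m x"
  by (auto intro!: blinfun_eqI simp: covec_apply blinfun.add_left blinfun.add_right blinfun.diff_left
      blinfun.diff_right blinfun.scaleR_left blinfun.scaleR_right blinfun.minus_left blinfun.minus_right
      algebra_simps)

lemma covec_zero: "covec 0 0 = 0"
  by (auto intro!: blinfun_eqI simp: covec_apply)

lemma lin_0_eq: "lin_0 x = blinfun_apply (covec 0 x)"
  and lin_1_eq: "lin_1 m = blinfun_apply (covec m 0)"
  by (auto simp: lin_0_def lin_1_def covec_apply)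

lemma permute_list_map_upt: "permute_list \<sigma> xs = map (\<lambda>i. xs ! \<sigma> i) [0..<length xs]"
  by (simp add: permute_list_def)

lemma length_2_conv: "length xs = 2 \<longleftrightarrow> (\<exists>a b. xs = [a, b])"
  and length_3_conv: "length xs = 3 \<longleftrightarrow> (\<exists>a b c. xs = [a, b, c])"
  by (auto simp: numeral_eq_Suc length_Suc_conv)

text \<open>The usual formula for the Lie derivative on constant covectors, where the Lie derivative
  of \<open>a\<close> is the differential of its pairing with \<open>X\<close>. In the last term
  \<open>a\<close> stands second, hence the plus sign: for alternating \<open>P\<close> this is the
  expected negative term.\<close>

lemma schouten_1_2:
  "schouten 1 2 (vector_field_mvf X) P g [a, b]
    = blinfun_apply (differential (\<lambda>p. P p [a, b]) g) (X g)
      - P g [differential (\<lambda>p. blinfun_apply a (X p)) g, b]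
      + P g [differential (\<lambda>p. blinfun_apply b (X p)) g, a]"
proof -
  let ?fs = "\<lambda>\<sigma>. permute_list \<sigma> (map blinfun_apply [a, b])"
  have "schouten 1 2 (vector_field_mvf X) P g [a, b]
      = mvf_apply (vector_field_mvf X) [mvf_apply P (map blinfun_apply [a, b])] g
        - (\<Sum>\<sigma>\<in>unshuffles 1 1. of_int (sign \<sigma>) *
            mvf_apply P (mvf_apply (vector_field_mvf X) (take 1 (?fs \<sigma>)) # drop 1 (?fs \<sigma>)) g)"
    by (simp add: schouten_def Let_def unshuffles_2_0 sign_id)
  also have "\<dots> = mvf_apply (vector_field_mvf X) [mvf_apply P (map blinfun_apply [a, b])] g
      - (mvf_apply P (mvf_apply (vector_field_mvf X) [blinfun_apply a] # [blinfun_apply b]) g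
         - mvf_apply P (mvf_apply (vector_field_mvf X) [blinfun_apply b] # [blinfun_apply a]) g)"
    by (simp only: sum_unshuffles_1_1) (simp add: permute_list_map_upt upt_rec)
  finally show ?thesis
    by (simp add: mvf_apply_def[abs_def] vector_field_mvf_def)
qed

lemma blinfun_triple:
  fixes \<theta> :: "('g::real_normed_vector \<times> 'g \<times> 'g) \<Rightarrow>\<^sub>L real"
  shows "blinfun_apply (\<theta> o\<^sub>L Blinfun (\<lambda>X. (X, 0, 0))) u = blinfun_apply \<theta> (u, 0, 0)"
    "blinfun_apply (\<theta> o\<^sub>L Blinfun (\<lambda>X. (0, X, 0))) u = blinfun_apply \<theta> (0, u, 0)"
    "blinfun_apply (\<theta> o\<^sub>L Blinfun (\<lambda>X. (0, 0, X))) u = blinfun_apply \<theta> (0, 0, u)"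
  by (simp_all add: bounded_linear_Blinfun_apply bounded_linear_Pair bounded_linear_ident bounded_linear_zero)


section \<open>The linear bivector field of a 2-term \<open>L\<^sub>\<infinity>\<close>-algebra\<close>

locale finite_dim_L_infinity = two_term_L_infinity l1 l20 l21 l3
  for l1 :: "'m::real_normed_vector \<Rightarrow> 'x::real_normed_vector" and l20 l21 l3 +
  assumes finite_dim_m: "\<exists>B :: 'm set. finite B \<and> span B = UNIV"
    and finite_dim_x: "\<exists>B :: 'x set. finite B \<and> span B = UNIV"
begin

lemmas lin_simps =
  linear_add[OF linear_l1] linear_add[OF linear_l20(1)] linear_add[OF linear_l20(2)]
  linear_add[OF linear_l21(1)] linear_add[OF linear_l21(2)]
  linear_add[OF linear_l3(1)] linear_add[OF linear_l3(2)] linear_add[OF linear_l3(3)]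
  linear_diff[OF linear_l1] linear_diff[OF linear_l20(1)] linear_diff[OF linear_l20(2)]
  linear_diff[OF linear_l21(1)] linear_diff[OF linear_l21(2)]
  linear_diff[OF linear_l3(1)] linear_diff[OF linear_l3(2)] linear_diff[OF linear_l3(3)]
  linear_neg[OF linear_l1] linear_neg[OF linear_l20(1)] linear_neg[OF linear_l20(2)]
  linear_neg[OF linear_l21(1)] linear_neg[OF linear_l21(2)]
  linear_neg[OF linear_l3(1)] linear_neg[OF linear_l3(2)] linear_neg[OF linear_l3(3)]
  linear_scale[OF linear_l1] linear_scale[OF linear_l20(1)] linear_scale[OF linear_l20(2)]
  linear_scale[OF linear_l21(1)] linear_scale[OF linear_l21(2)]
  linear_scale[OF linear_l3(1)] linear_scale[OF linear_l3(2)] linear_scale[OF linear_l3(3)]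
  linear_0[OF linear_l1] linear_0[OF linear_l20(1)] linear_0[OF linear_l20(2)]
  linear_0[OF linear_l21(1)] linear_0[OF linear_l21(2)]

lemmas blin_simps = blinfun.add_left blinfun.add_right blinfun.diff_left blinfun.diff_right
  blinfun.scaleR_left blinfun.scaleR_right blinfun.minus_left blinfun.minus_right

lemma bounded_linear_l1: "bounded_linear l1"
  by (rule bounded_linear_finite_dim[OF finite_dim_m linear_l1])

lemma l1_dual_apply: "blinfun_apply (l1_dual l1 \<xi>) m = - blinfun_apply \<xi> (l1 m)"
  using bounded_linear_minus[OF bounded_linear_compose[OF blinfun.bounded_linear_right[of \<xi>] bounded_linear_l1]]
  by (simp add: l1_dual_def bounded_linear_Blinfun_apply)

lemma l1_dual_add: "l1_dual l1 (\<xi> + \<eta>) = l1_dual l1 \<xi> + l1_dual l1 \<eta>"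
  and l1_dual_scaleR: "l1_dual l1 (c *\<^sub>R \<xi>) = c *\<^sub>R l1_dual l1 \<xi>"
  and l1_dual_minus: "l1_dual l1 (- \<xi>) = - l1_dual l1 \<xi>"
  and l1_dual_zero: "l1_dual l1 0 = 0"
  by (auto intro!: blinfun_eqI simp: l1_dual_apply blin_simps)

lemma bounded_linear_l1_dual: "bounded_linear (l1_dual l1)"
proof -
  have "l1_dual l1 = (\<lambda>\<xi>. - (\<xi> o\<^sub>L Blinfun l1))"
    by (auto intro!: ext blinfun_eqI
        simp: l1_dual_apply blin_simps bounded_linear_Blinfun_apply[OF bounded_linear_l1])
  then show ?thesis
    by (auto intro!: bounded_linear_minus bounded_bilinear.bounded_linear_left[OF bounded_bilinear_blinfun_compose])
qed

lemma anchor_Adual_apply: "blinfun_apply (anchor_Adual l21 \<alpha> x) m = blinfun_apply \<alpha> (l21 x m)"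
  using bounded_linear_compose[OF blinfun.bounded_linear_right[of \<alpha>]
      bounded_linear_finite_dim[OF finite_dim_m linear_l21(2)]]
  by (simp add: anchor_Adual_def bounded_linear_Blinfun_apply)

lemma linear_anchor_Adual: "linear (anchor_Adual l21 \<alpha>)"
  by (rule linearI) (auto intro!: blinfun_eqI simp: anchor_Adual_apply blin_simps lin_simps)

text \<open>The restrictions of a covector to the two factors are linear forms on dual spaces, hence
  evaluations at vectors \<open>m\<close> and \<open>x\<close>.\<close>

lemma covec_exhaust:
  fixes \<theta> :: "('m, 'x) arrows \<Rightarrow>\<^sub>L real"
  obtains m x where "\<theta> = covec m x"
proof -
  have lin: "linear (\<lambda>\<alpha>. blinfun_apply \<theta> (\<alpha>, 0))" "linear (\<lambda>\<xi>. blinfun_apply \<theta> (0, \<xi>))"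
    by (intro bounded_linear.linear bounded_linear_compose[OF blinfun.bounded_linear_right]
        bounded_linear_Pair bounded_linear_ident bounded_linear_zero)+
  obtain m where m: "\<And>\<alpha>. blinfun_apply \<theta> (\<alpha>, 0) = blinfun_apply \<alpha> m"
    using linear_functional_on_dual[OF finite_dim_m lin(1)] by blast
  obtain x where x: "\<And>\<xi>. blinfun_apply \<theta> (0, \<xi>) = blinfun_apply \<xi> x"
    using linear_functional_on_dual[OF finite_dim_x lin(2)] by blast
  have "\<theta> = covec m x"
  proof (rule blinfun_eqI)
    fix g
    have "blinfun_apply \<theta> g = blinfun_apply \<theta> ((fst g, 0) + (0, snd g))" by simp
    then show "blinfun_apply \<theta> g = blinfun_apply (covec m x) g"
      by (simp only: blinfun.add_right m x covec_apply)
  qed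
  then show ?thesis by (rule that)
qed

section \<open>The two components of a covector, and the linear bivector field\<close>

definition part1 :: "(('m, 'x) arrows \<Rightarrow>\<^sub>L real) \<Rightarrow> 'm" where
  "part1 \<theta> = from_bidual (\<lambda>\<alpha>. blinfun_apply \<theta> (\<alpha>, 0))"

text \<open>Written with \<open>left_vector\<close> so that it is literally the entry that occurs in
  \<open>left_mvf\<close>.\<close>

definition part0 :: "(('m, 'x) arrows \<Rightarrow>\<^sub>L real) \<Rightarrow> 'x" where
  "part0 \<theta> = from_bidual (\<lambda>\<xi>. blinfun_apply \<theta> (left_vector \<xi>))"

lemma part1_covec [simp]: "part1 (covec m x) = m"
  unfolding part1_def by (rule from_bidual_eq[OF finite_dim_m]) (simp add: covec_apply)

lemma part0_covec [simp]: "part0 (covec m x) = x"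
  unfolding part0_def by (rule from_bidual_eq[OF finite_dim_x]) (simp add: covec_apply left_vector_def)

lemma covec_parts [simp]: "covec (part1 \<theta>) (part0 \<theta>) = \<theta>"
  by (rule covec_exhaust[of \<theta>]) simp

text \<open>The first component of \<open>right_vector l1 \<eta>\<close> pairs with \<open>m\<close>
  to \<eta> (l1 m), as the sign in \<open>l1_dual\<close> cancels the one in
  \<open>right_vector\<close>. This shift by \<open>l1 m\<close> is the difference between left and
  right translates.\<close>

lemma from_bidual_right: "from_bidual (\<lambda>\<eta>. blinfun_apply (covec m x) (right_vector l1 \<eta>)) = x + l1 m"
  by (rule from_bidual_eq[OF finite_dim_x])
    (simp add: covec_apply right_vector_def l1_dual_apply blin_simps)

lemma linear_part1: "linear part1" and linear_part0: "linear part0"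
proof -
  have "part1 (\<theta> + \<eta>) = part1 \<theta> + part1 \<eta> \<and> part0 (\<theta> + \<eta>) = part0 \<theta> + part0 \<eta>" for \<theta> \<eta>
    by (rule covec_exhaust[of \<theta>], rule covec_exhaust[of \<eta>]) (simp flip: covec_add)
  moreover have "part1 (c *\<^sub>R \<theta>) = c *\<^sub>R part1 \<theta> \<and> part0 (c *\<^sub>R \<theta>) = c *\<^sub>R part0 \<theta>" for c \<theta>
    by (rule covec_exhaust[of \<theta>]) (simp flip: covec_scaleR)
  ultimately show "linear part1" "linear part0" by (auto intro: linearI)
qed

text \<open>The bracket \<open>\<Pi>(df, df')\<close> of the linear functions \<open>f = covec m x\<close> and \<open>f' = covec n y\<close>.\<close>

definition linear_bracket :: "'m \<Rightarrow> 'x \<Rightarrow> 'm \<Rightarrow> 'x \<Rightarrow> ('m, 'x) arrows \<Rightarrow>\<^sub>L real" where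
  "linear_bracket m x n y = covec (l21 y m - l21 x n - l21 (l1 m) n) (- l20 x y)"

definition linear_bivector :: "('m, 'x) arrows mvf" where
  "linear_bivector g \<theta>s = (if length \<theta>s = 2 then
     blinfun_apply (linear_bracket (part1 (\<theta>s ! 0)) (part0 (\<theta>s ! 0)) (part1 (\<theta>s ! 1)) (part0 (\<theta>s ! 1))) g
     else 0)"

lemma linear_bivector_covec [simp]:
  "linear_bivector g [covec m x, covec n y] = blinfun_apply (linear_bracket m x n y) g"
  by (simp add: linear_bivector_def)

lemma linear_linear_bracket:
  "linear (\<lambda>\<theta>. blinfun_apply (linear_bracket (part1 \<theta>) (part0 \<theta>) n y) g)"
  "linear (\<lambda>\<theta>. blinfun_apply (linear_bracket m x (part1 \<theta>) (part0 \<theta>)) g)"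
  by (auto intro!: linearI simp: linear_bracket_def covec_apply lin_simps blin_simps algebra_simps
      linear_add[OF linear_part1] linear_add[OF linear_part0]
      linear_scale[OF linear_part1] linear_scale[OF linear_part0])

lemma linear_bracket_self: "linear_bracket m x m x = 0"
proof -
  have "l20 x x = 0" using skew_l20[of x x] by (simp add: eq_neg_iff_add_eq_0 flip: scaleR_2)
  moreover have "l21 (l1 m) m = 0" using l21_l1[of m m] by (simp add: eq_neg_iff_add_eq_0 flip: scaleR_2)
  ultimately show ?thesis by (simp add: linear_bracket_def covec_zero)
qed

lemma bivector_field_linear_bivector: "multivector_field 2 linear_bivector"
proof -
  have "linear (\<lambda>u. linear_bivector p (us[i := u]))" if us: "length us = 2" "i < 2" for p us i
  proof -
    have "linear_bivector p ([a, b][i := u])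
      = (if i = 0 then blinfun_apply (linear_bracket (part1 u) (part0 u) (part1 b) (part0 b)) p
         else blinfun_apply (linear_bracket (part1 a) (part0 a) (part1 u) (part0 u)) p)" for a b u
      using us(2) by (auto simp: linear_bivector_def less_2_cases_iff)
    then show ?thesis
      using us(1) by (cases "i = 0") (auto simp: length_2_conv linear_linear_bracket simp del: list_update.simps)
  qed
  moreover have "linear_bivector p us = 0"
    if "length us = 2" "i < 2" "j < 2" "i \<noteq> j" "us ! i = us ! j" for p us i j
    using that by (auto simp: length_2_conv less_2_cases_iff linear_bivector_def linear_bracket_self)
  moreover have "smooth (\<lambda>p. linear_bivector p us)" for us
    by (cases "length us = 2")
      (auto simp: linear_bivector_def smooth_const intro: smooth_bounded_linear blinfun.bounded_linear_right)
  ultimately show ?thesis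
    unfolding wedge_section_def alternating_form_def by (auto simp: linear_bivector_def)
qed

text \<open>Every covector is some \<open>covec m x\<close>, and on lists of other lengths both
  fields have the default value 0 prescribed by \<open>alternating_form\<close>.\<close>

lemma bivector_eqI:
  assumes "multivector_field 2 \<pi>"
    and "\<And>g m x n y. \<pi> g [covec m x, covec n y] = blinfun_apply (linear_bracket m x n y) g"
  shows "\<pi> = linear_bivector"
proof (intro ext)
  fix g \<theta>s
  show "\<pi> g \<theta>s = linear_bivector g \<theta>s"
  proof (cases "length \<theta>s = 2")
    case True
    then obtain \<theta> \<eta> where "\<theta>s = [\<theta>, \<eta>]" by (auto simp: length_2_conv)
    then show ?thesis
      using assms(2)[of g "part1 \<theta>" "part0 \<theta>" "part1 \<eta>" "part0 \<eta>"] by (simp add: linear_bivector_def)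
  next
    case False
    then show ?thesis
      using assms(1) unfolding wedge_section_def alternating_form_def by (metis linear_bivector_def)
  qed
qed

text \<open>Splitting each covector into its two components expands the value on a pair into four
  terms by bilinearity. Three are prescribed directly, and the one on \<open>covec m 0\<close> and
  \<open>covec 0 y\<close> follows from the mixed rule by skewness.\<close>

lemma characterized_bivector:
  "multivector_field 2 \<pi> \<and>
     (\<forall>g x y m n.
        \<pi> g [differential (lin_0 x) g, differential (lin_0 y) g] = - lin_0 (l20 x y) g \<and>
        \<pi> g [differential (lin_0 x) g, differential (lin_1 m) g] = - lin_1 (l21 x m) g \<and>
        \<pi> g [differential (lin_1 m) g, differential (lin_1 n) g] = - lin_1 (l21 (l1 m) n) g)
   \<longleftrightarrow> \<pi> = linear_bivector" (is "?L \<longleftrightarrow> _")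
proof
  assume L: ?L
  then have alt: "alternating_form 2 (\<pi> g)" for g unfolding wedge_section_def by blast
  have 1: "\<pi> g [covec 0 x, covec 0 y] = - lin_0 (l20 x y) g"
    and 2: "\<pi> g [covec 0 x, covec m 0] = - lin_1 (l21 x m) g"
    and 3: "\<pi> g [covec m 0, covec n 0] = - lin_1 (l21 (l1 m) n) g" for g x y m n
    using L unfolding lin_0_eq lin_1_eq differential_blinfun by blast+
  have split: "covec m x = covec 0 x + covec m 0" for m :: 'm and x :: 'x by (simp flip: covec_add)
  have "\<pi> g [covec m x, covec n y] = blinfun_apply (linear_bracket m x n y) g" for g m x n y
  proof -
    have "\<pi> g [covec m x, covec n y] = \<pi> g [covec 0 x, covec 0 y] + \<pi> g [covec 0 x, covec n 0]
        + (- \<pi> g [covec 0 y, covec m 0] + \<pi> g [covec m 0, covec n 0])"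
      unfolding split[of m x] split[of n y]
      by (simp add: linear_add[OF alternating_form_2(1)[OF alt]]
          linear_add[OF alternating_form_2(2)[OF alt]] alternating_form_2(3)[OF alt, of g "covec m 0" "covec 0 y"])
    also have "\<dots> = blinfun_apply (linear_bracket m x n y) g"
      by (simp add: 1 2 3 lin_0_eq lin_1_eq linear_bracket_def covec_apply blin_simps)
    finally show ?thesis .
  qed
  with L show "\<pi> = linear_bivector" by (intro bivector_eqI) auto
next
  assume "\<pi> = linear_bivector"
  then show ?L
    by (simp add: bivector_field_linear_bivector lin_0_eq lin_1_eq linear_bracket_def covec_apply
        lin_simps blin_simps)
qed

section \<open>The action groupoid and its Lie algebroid\<close>

lemma bounded_linear_tgt: "bounded_linear (tgt (action_groupoid l1))"
proof -
  have "tgt (action_groupoid l1) = (\<lambda>g. fst g + l1_dual l1 (snd g))"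
    by (auto simp: action_groupoid_def)
  then show ?thesis
    by (auto intro!: bounded_linear_add bounded_linear_fst
        bounded_linear_compose[OF bounded_linear_l1_dual bounded_linear_snd])
qed

lemma bounded_linear_src: "bounded_linear (src (action_groupoid l1))"
  by (simp add: action_groupoid_def case_prod_unfold bounded_linear_fst)

lemma tgt_apply: "tgt (action_groupoid l1) g = fst g + l1_dual l1 (snd g)"
  and src_apply: "src (action_groupoid l1) g = fst g"
  by (auto simp: action_groupoid_def split: prod.splits)

lemma lie_groupoid_action: "lie_groupoid (action_groupoid l1)"
proof -
  \<comment> \<open>Inversion, and an extension of the product to all pairs of arrows. Both are
    linear, hence smooth.\<close>
  let ?i = "\<lambda>g :: ('m, 'x) arrows. (fst g + l1_dual l1 (snd g), - snd g)"
  let ?F = "\<lambda>p :: ('m, 'x) arrows \<times> ('m, 'x) arrows. (fst (fst p), snd (fst p) + snd (snd p))"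
  have "bounded_linear ?i"
    by (intro bounded_linear_Pair bounded_linear_add bounded_linear_minus bounded_linear_fst bounded_linear_snd
        bounded_linear_compose[OF bounded_linear_l1_dual bounded_linear_snd])
  then have i: "smooth ?i" by (rule smooth_bounded_linear)
  have "bounded_linear ?F"
    by (intro bounded_linear_Pair bounded_linear_add bounded_linear_fst_comp bounded_linear_snd_comp
        bounded_linear_fst bounded_linear_snd)
  then have F: "smooth ?F" by (rule smooth_bounded_linear)
  have "bounded_linear (\<lambda>\<alpha>. (\<alpha>, 0) :: ('m, 'x) arrows)"
    by (intro bounded_linear_Pair bounded_linear_ident bounded_linear_zero)
  then have unit: "smooth (unit (action_groupoid l1))"
    by (simp add: action_groupoid_def smooth_bounded_linear)
  have "surj (tgt (action_groupoid l1))"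
    by (rule surjI[of _ "\<lambda>\<alpha>. (\<alpha>, 0)"]) (simp add: tgt_apply l1_dual_zero)
  moreover have "surj (src (action_groupoid l1))"
    by (rule surjI[of _ "\<lambda>\<alpha>. (\<alpha>, 0)"]) (simp add: src_apply)
  moreover have "\<exists>i. smooth i \<and> (\<forall>g. src (action_groupoid l1) (i g) = tgt (action_groupoid l1) g \<and>
      tgt (action_groupoid l1) (i g) = src (action_groupoid l1) g \<and>
      mult (action_groupoid l1) g (i g) = unit (action_groupoid l1) (src (action_groupoid l1) g) \<and>
      mult (action_groupoid l1) (i g) g = unit (action_groupoid l1) (tgt (action_groupoid l1) g))"
    by (intro exI[of _ ?i] conjI i) (auto simp: action_groupoid_def l1_dual_minus)
  moreover have "\<exists>F. smooth F \<and> (\<forall>g h. tgt (action_groupoid l1) g = src (action_groupoid l1) h \<longrightarrow>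
      F (g, h) = mult (action_groupoid l1) g h)"
    by (intro exI[of _ ?F] conjI F) (auto simp: action_groupoid_def)
  ultimately show ?thesis
    unfolding lie_groupoid_def frechet_derivative_bounded_linear[OF bounded_linear_tgt]
      frechet_derivative_bounded_linear[OF bounded_linear_src]
    by (simp add: unit smooth_bounded_linear[OF bounded_linear_tgt] smooth_bounded_linear[OF bounded_linear_src])
      (auto simp: action_groupoid_def l1_dual_zero l1_dual_add algebra_simps)
qed

lemma bounded_linear_right_vector: "bounded_linear (right_vector l1)"
proof -
  have "right_vector l1 = (\<lambda>\<eta>. (- l1_dual l1 \<eta>, \<eta>))" by (auto simp: right_vector_def)
  then show ?thesis
    by (simp add: bounded_linear_Pair bounded_linear_minus bounded_linear_l1_dual)
qed

text \<open>A right translate depends on the source alone, and through the linear map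
  \<open>right_vector l1\<close>.\<close>

lemma frechet_derivative_right_field:
  assumes "smooth e"
  shows "frechet_derivative (right_field l1 e) (at g) v
    = right_vector l1 (frechet_derivative e (at (fst g)) (fst v))"
proof -
  have "(e has_derivative frechet_derivative e (at (fst g))) (at (fst g))"
    using smooth_imp_differentiable[OF assms] by (simp add: frechet_derivative_works)
  then have "((\<lambda>g. e (fst g)) has_derivative (\<lambda>v. frechet_derivative e (at (fst g)) (fst v))) (at g)"
    by (rule has_derivative_compose[rotated]) (rule has_derivative_fst[OF has_derivative_ident])
  then have "((\<lambda>g. right_vector l1 (e (fst g))) has_derivative
      (\<lambda>v. right_vector l1 (frechet_derivative e (at (fst g)) (fst v)))) (at g)"
    by (rule bounded_linear.has_derivative[OF bounded_linear_right_vector])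
  moreover have "right_field l1 e = (\<lambda>g. right_vector l1 (e (fst g)))"
    by (simp add: right_field_def src_apply fun_eq_iff)
  ultimately show ?thesis
    by (simp flip: frechet_derivative_at)
qed

text \<open>The kernel of the target map is the graph of minus \<open>l1_dual l1\<close>, that is,
  the range of \<open>right_vector l1\<close>. Differentiating a right translate along another one
  sees only the first component of the latter, which is the anchor; hence the two brackets
  agree.\<close>

lemma integrates_A_action: "integrates_A l1"
  unfolding integrates_A_def
proof (intro conjI allI impI)
  fix \<alpha>
  have "{v. tgt (action_groupoid l1) v = 0} = range (right_vector l1)"
    by (auto simp: tgt_apply right_vector_def eq_neg_iff_add_eq_0 image_iff prod_eq_iff)
  then show "bij_betw (right_vector l1) UNIV
      {v. frechet_derivative (tgt (action_groupoid l1)) (at (unit (action_groupoid l1) \<alpha>)) v = 0}"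
    by (auto simp: frechet_derivative_bounded_linear[OF bounded_linear_tgt] bij_betw_def inj_on_def right_vector_def)
next
  fix e g
  show "frechet_derivative (src (action_groupoid l1)) (at g) (right_field l1 e g)
      = anchor_A l1 (e (src (action_groupoid l1) g))"
    by (simp add: frechet_derivative_bounded_linear[OF bounded_linear_src] src_apply right_field_def
        right_vector_def anchor_A_def)
next
  fix e e' :: "('m \<Rightarrow>\<^sub>L real) \<Rightarrow> ('x \<Rightarrow>\<^sub>L real)"
  assume "smooth e \<and> smooth e'"
  then show "lie_bracket (right_field l1 e) (right_field l1 e') = right_field l1 (bracket_A l1 e e')"
    by (auto simp: fun_eq_iff lie_bracket_def frechet_derivative_right_field right_field_def src_apply
        bracket_A_def anchor_A_def right_vector_def linear_diff[OF bounded_linear.linear[OF bounded_linear_right_vector], symmetric]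
        linear_diff[OF bounded_linear.linear[OF bounded_linear_l1_dual]])
qed


subsection \<open>Multiplicativity\<close>

lemma linear_bracket_multiplicative:
  "blinfun_apply (linear_bracket m (x + l1 n) m' (x' + l1 n')) (\<alpha>, \<xi>)
     + blinfun_apply (linear_bracket n x n' x') (\<alpha> + l1_dual l1 \<xi>, \<eta>)
   = blinfun_apply (linear_bracket (- (m + n)) (- x) (- (m' + n')) (- x')) (\<alpha>, \<xi> + \<eta>)"
  using l21_l1[of n' m] l21_l1[of n' n] l21_l1[of m' n] skew_l20[of "l1 n" x']
  by (simp add: linear_bracket_def covec_apply lin_simps blin_simps l1_dual_apply l1_l21 algebra_simps)

text \<open>The graph is a linear subspace, so the line through \<open>p\<close> in the direction of
  one of its elements stays inside it.\<close>

lemma tangent_vectors_mult_graph: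
  assumes "p \<in> mult_graph (action_groupoid l1)"
  shows "((\<alpha>, \<xi>), (\<alpha> + l1_dual l1 \<xi>, \<eta>), (\<alpha>, \<xi> + \<eta>))
    \<in> tangent_vectors (mult_graph (action_groupoid l1)) p"
proof -
  let ?v = "((\<alpha>, \<xi>), (\<alpha> + l1_dual l1 \<xi>, \<eta>), (\<alpha>, \<xi> + \<eta>))"
  let ?\<gamma> = "\<lambda>t :: real. p + t *\<^sub>R ?v"
  have "bounded_linear (\<lambda>t :: real. t *\<^sub>R ?v)"
    by (rule bounded_linear_scaleR_left)
  then have "smooth ?\<gamma>" by (rule smooth_affine)
  moreover have "range ?\<gamma> \<subseteq> mult_graph (action_groupoid l1)"
    using assms by (auto simp: mult_graph_def action_groupoid_def l1_dual_add l1_dual_scaleR algebra_simps)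
  moreover have "(?\<gamma> has_vector_derivative ?v) (at 0)"
    by (auto intro!: derivative_eq_intros)
  ultimately show ?thesis
    unfolding tangent_vectors_def by (auto intro!: exI[of _ ?\<gamma>] simp: zero_prod_def[symmetric])
qed

text \<open>Testing \<theta> on tangent vectors in which only \<alpha>, only \<xi> or only \<eta> is
  nonzero gives one linear relation each between its six components.\<close>

lemma conormal_mult_graph:
  assumes p: "p \<in> mult_graph (action_groupoid l1)"
    and \<theta>: "\<theta> \<in> conormal_covectors (mult_graph (action_groupoid l1)) p"
  obtains m n x where "\<theta> o\<^sub>L Blinfun (\<lambda>X. (X, 0, 0)) = covec m (x + l1 n)"
    "\<theta> o\<^sub>L Blinfun (\<lambda>X. (0, X, 0)) = covec n x"
    "\<theta> o\<^sub>L Blinfun (\<lambda>X. (0, 0, X)) = covec (- (m + n)) (- x)"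
proof -
  obtain m x1 where 1: "\<theta> o\<^sub>L Blinfun (\<lambda>X. (X, 0, 0)) = covec m x1" by (rule covec_exhaust)
  obtain n x where 2: "\<theta> o\<^sub>L Blinfun (\<lambda>X. (0, X, 0)) = covec n x" by (rule covec_exhaust)
  obtain k x3 where 3: "\<theta> o\<^sub>L Blinfun (\<lambda>X. (0, 0, X)) = covec k x3" by (rule covec_exhaust)
  have zero: "blinfun_apply (covec m x1) (\<alpha>, \<xi>) + blinfun_apply (covec n x) (\<alpha> + l1_dual l1 \<xi>, \<eta>)
      + blinfun_apply (covec k x3) (\<alpha>, \<xi> + \<eta>) = 0" for \<alpha> \<xi> \<eta>
  proof -
    have "blinfun_apply \<theta> ((\<alpha>, \<xi>), (\<alpha> + l1_dual l1 \<xi>, \<eta>), (\<alpha>, \<xi> + \<eta>)) = 0"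
      using \<theta> tangent_vectors_mult_graph[OF p] unfolding conormal_covectors_def by blast
    then show ?thesis
      unfolding 1[symmetric] 2[symmetric] 3[symmetric] blinfun_triple blinfun.add_right[symmetric] by simp
  qed
  have k: "m + n + k = 0"
    by (rule blinfun_separates_points[OF finite_dim_m])
      (use zero[of _ 0 0] in \<open>simp add: covec_apply blin_simps l1_dual_zero\<close>)
  have x3: "x + x3 = 0"
    by (rule blinfun_separates_points[OF finite_dim_x])
      (use zero[of 0 0] in \<open>simp add: covec_apply blin_simps l1_dual_zero\<close>)
  have "x1 - l1 n + x3 = 0"
    by (rule blinfun_separates_points[OF finite_dim_x])
      (use zero[of 0 _ 0] in \<open>simp add: covec_apply blin_simps l1_dual_apply\<close>)
  then have "x1 = x + l1 n"
    using x3 by (metis add_right_cancel diff_eq_eq)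
  moreover have "k = - (m + n)" "x3 = - x"
    using k x3 by (simp_all only: add_eq_0_iff)
  ultimately show ?thesis using that 1 2 3 by blast
qed

lemma multiplicative_linear_bivector: "multiplicative (action_groupoid l1) linear_bivector"
  unfolding multiplicative_def coisotropic_def
proof (intro ballI)
  fix p \<theta> \<eta>
  assume p: "p \<in> mult_graph (action_groupoid l1)"
    and \<theta>: "\<theta> \<in> conormal_covectors (mult_graph (action_groupoid l1)) p"
    and \<eta>: "\<eta> \<in> conormal_covectors (mult_graph (action_groupoid l1)) p"
  obtain \<alpha> \<xi> \<zeta> where p_eq: "p = ((\<alpha>, \<xi>), (\<alpha> + l1_dual l1 \<xi>, \<zeta>), (\<alpha>, \<xi> + \<zeta>))"
    using p by (auto simp: mult_graph_def action_groupoid_def)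
  show "triple_bivector linear_bivector p [\<theta>, \<eta>] = 0"
    by (rule conormal_mult_graph[OF p \<theta>], rule conormal_mult_graph[OF p \<eta>])
      (simp add: triple_bivector_def p_eq linear_bracket_multiplicative del: minus_add_distrib)
qed

text \<open>The product adds the second components of the arrows, so this covector vanishes on the
  graph. Such covectors are what uniqueness needs to exploit multiplicativity.\<close>

lemma conormal_multiplication_covector:
  fixes x :: 'x
  defines "\<theta> \<equiv> Blinfun (\<lambda>p :: ('m, 'x) arrows \<times> ('m, 'x) arrows \<times> ('m, 'x) arrows.
    blinfun_apply (covec 0 x) (fst p + fst (snd p) - snd (snd p)))"
  shows "\<theta> \<in> conormal_covectors (mult_graph (action_groupoid l1)) p"
    and "\<theta> o\<^sub>L Blinfun (\<lambda>X. (X, 0, 0)) = covec 0 x"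
    and "\<theta> o\<^sub>L Blinfun (\<lambda>X. (0, X, 0)) = covec 0 x"
    and "\<theta> o\<^sub>L Blinfun (\<lambda>X. (0, 0, X)) = - covec 0 x"
proof -
  have "bounded_linear (\<lambda>p :: ('m, 'x) arrows \<times> ('m, 'x) arrows \<times> ('m, 'x) arrows.
      blinfun_apply (covec 0 x) (fst p + fst (snd p) - snd (snd p)))"
    by (intro bounded_linear_compose[OF blinfun.bounded_linear_right] bounded_linear_sub bounded_linear_add
        bounded_linear_fst bounded_linear_snd bounded_linear_fst_comp bounded_linear_snd_comp)
  then have \<theta>: "blinfun_apply \<theta> p = blinfun_apply (covec 0 x) (fst p + fst (snd p) - snd (snd p))" for p
    by (simp add: \<theta>_def bounded_linear_Blinfun_apply)
  show "\<theta> \<in> conormal_covectors (mult_graph (action_groupoid l1)) p"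
    unfolding conormal_covectors_def tangent_vectors_def
  proof (safe)
    fix v and \<gamma> :: "real \<Rightarrow> ('m, 'x) arrows \<times> ('m, 'x) arrows \<times> ('m, 'x) arrows"
    assume "range \<gamma> \<subseteq> mult_graph (action_groupoid l1)" and \<gamma>: "(\<gamma> has_vector_derivative v) (at 0)"
    then have graph: "\<gamma> t \<in> mult_graph (action_groupoid l1)" for t by auto
    \<comment> \<open>The covector is constant along any curve in the graph, so it kills the
      velocity.\<close>
    have zero: "blinfun_apply \<theta> (\<gamma> t) = 0" for t
      using graph[of t] by (auto simp: mult_graph_def action_groupoid_def \<theta> covec_apply blin_simps)
    have "((\<lambda>t. blinfun_apply \<theta> (\<gamma> t)) has_vector_derivative blinfun_apply \<theta> v) (at 0)"
      by (rule bounded_linear.has_vector_derivative[OF blinfun.bounded_linear_right \<gamma>])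
    then have "((\<lambda>_. 0) has_vector_derivative blinfun_apply \<theta> v) (at 0)"
      by (simp only: zero)
    from vector_derivative_unique_at[OF this has_vector_derivative_const]
    show "blinfun_apply \<theta> v = 0" .
  qed
  show "\<theta> o\<^sub>L Blinfun (\<lambda>X. (X, 0, 0)) = covec 0 x"
    "\<theta> o\<^sub>L Blinfun (\<lambda>X. (0, X, 0)) = covec 0 x"
    "\<theta> o\<^sub>L Blinfun (\<lambda>X. (0, 0, X)) = - covec 0 x"
    by (rule blinfun_eqI; simp only: blinfun_triple \<theta>; simp add: blin_simps)+
qed

text \<open>A unit composed with itself is the same unit, so coisotropy on the covectors above says
  that the value, taken twice with plus and once with minus, is zero.\<close>

lemma multiplicative_unit:
  assumes "multivector_field 2 \<pi>" "multiplicative (action_groupoid l1) \<pi>"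
  shows "\<pi> (\<alpha>, 0) [covec 0 x, covec 0 y] = 0"
proof -
  have alt: "alternating_form 2 (\<pi> g)" for g using assms(1) unfolding wedge_section_def by blast
  note lin = alternating_form_2(1,2)[OF alt]
  have "((\<alpha>, 0), (\<alpha>, 0), (\<alpha>, 0)) \<in> mult_graph (action_groupoid l1)"
    by (auto simp: mult_graph_def action_groupoid_def l1_dual_zero)
  then have "triple_bivector \<pi> ((\<alpha>, 0), (\<alpha>, 0), (\<alpha>, 0)) [\<theta>, \<eta>] = 0"
    if "\<theta> \<in> conormal_covectors (mult_graph (action_groupoid l1)) ((\<alpha>, 0), (\<alpha>, 0), (\<alpha>, 0))"
      "\<eta> \<in> conormal_covectors (mult_graph (action_groupoid l1)) ((\<alpha>, 0), (\<alpha>, 0), (\<alpha>, 0))" for \<theta> \<eta>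
    using assms(2) that unfolding multiplicative_def coisotropic_def by blast
  from this[OF conormal_multiplication_covector(1)[of x] conormal_multiplication_covector(1)[of y]]
  show ?thesis
    by (simp add: triple_bivector_def conormal_multiplication_covector(2-4) linear_neg[OF lin(1)] linear_neg[OF lin(2)])
qed


subsection \<open>Schouten brackets\<close>

lemma wedge_section_phi: "wedge_section 3 (phi l3)"
proof -
  have diag: "l3 x x y = 0" "l3 x y y = 0" "l3 y x y = 0" for x y
  proof -
    show 1: "l3 x x y = 0" for x y
      using skew_l3(1)[of x x y] by (simp add: eq_neg_iff_add_eq_0 flip: scaleR_2)
    show "l3 x y y = 0" using skew_l3(2)[of x y y] by (simp add: eq_neg_iff_add_eq_0 flip: scaleR_2)
    show "l3 y x y = 0" using skew_l3(2)[of y y x] 1 by simp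
  qed
  have lin: "linear (\<lambda>u. phi l3 \<alpha> (us[i := u]))" if "length us = 3" "i < 3" for \<alpha> us i
  proof -
    have "i = 0 \<or> i = 1 \<or> i = 2" using that(2) by auto
    then show ?thesis
      using that(1) by (auto intro!: linearI simp: length_3_conv phi_def lin_simps blin_simps)
  qed
  have alt: "phi l3 \<alpha> us = 0" if "length us = 3" "i < 3" "j < 3" "i \<noteq> j" "us ! i = us ! j" for \<alpha> us i j
  proof -
    have "i = 0 \<or> i = 1 \<or> i = 2" "j = 0 \<or> j = 1 \<or> j = 2" using that(2,3) by auto
    then show ?thesis
      using that(1,4,5) by (auto simp: length_3_conv phi_def diag)
  qed
  have "smooth (\<lambda>\<alpha>. phi l3 \<alpha> us)" for us
    by (cases "length us = 3")
      (auto simp: phi_def smooth_const intro: smooth_bounded_linear[OF bounded_linear_minus[OF blinfun.bounded_linear_left]])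
  with lin alt show ?thesis
    unfolding wedge_section_def alternating_form_def by (auto simp: phi_def)
qed

lemma left_mvf_eq: "left_mvf l1 \<psi> g \<theta>s = \<psi> (tgt (action_groupoid l1) g) (map part0 \<theta>s)"
  by (simp add: left_mvf_def part0_def[abs_def])

lemma right_mvf_eq:
  "right_mvf l1 \<psi> g \<theta>s = \<psi> (src (action_groupoid l1) g) (map (\<lambda>\<theta>. part0 \<theta> + l1 (part1 \<theta>)) \<theta>s)"
proof -
  have "from_bidual (\<lambda>\<eta>. blinfun_apply \<theta> (right_vector l1 \<eta>)) = part0 \<theta> + l1 (part1 \<theta>)" for \<theta>
    using from_bidual_right[of "part1 \<theta>" "part0 \<theta>"] by simp
  then show ?thesis by (simp add: right_mvf_def)
qed

text \<open>Brackets of linear functions are linear, so iterated brackets reduce to algebra on the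
  pairs \<open>(m, x)\<close>.\<close>

lemma mvf_apply_linear_bivector:
  "mvf_apply linear_bivector [blinfun_apply (covec m x), blinfun_apply (covec n y)]
    = blinfun_apply (linear_bracket m x n y)"
  by (auto simp: mvf_apply_def fun_eq_iff)

section \<open>The Jacobiator and the bracket of the bivector field with itself\<close>

lemma jacobiator_0: "l20 (l20 x y) z - l20 (l20 x z) y + l20 (l20 y z) x = - l1 (l3 x y z)"
proof -
  have swap: "l20 (l20 z x) y = - l20 (l20 x z) y" by (simp add: skew_l20[of x z] lin_simps)
  show ?thesis using jacobi_0[of x y z] unfolding swap by (simp add: eq_neg_iff_add_eq_0 algebra_simps)
qed

text \<open>The next three rules rewrite every \<open>l1\<close> away except inside \<open>l21 (l1 _) _\<close>, so that the
  Jacobiator becomes a sum of comparable terms.\<close>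

lemma l3_l1: "l3 x y (l1 m) = l21 x (l21 y m) - l21 y (l21 x m) - l21 (l20 x y) m"
  using jacobi_1[of x y m] by (simp add: lin_simps eq_neg_iff_add_eq_0 algebra_simps add_eq_0_iff)

lemma l20_l1: "l20 x (l1 m) = l1 (l21 x m)" "l20 (l1 m) x = - l1 (l21 x m)"
  by (simp_all add: l1_l21 skew_l20[of _ "l1 m"])

lemma l21_l1_l21: "l21 (l1 (l21 x m)) n = - l21 (l1 n) (l21 x m)"
  by (rule l21_l1)

text \<open>\<open>M\<close> is the first component of \<open>linear_bracket\<close>, so the left
  side is that component of the Jacobiator. On the right, expanding the second \<open>l3\<close>
  leaves only terms with some entry in the image of \<open>l1\<close>, besides a copy of
  \<open>l3 x y z\<close> that cancels; \<open>jacobi_1\<close> expresses them by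
  \<open>l21\<close>.\<close>

lemma jacobiator_1:
  fixes m n p :: 'm and x y z :: 'x
  defines "M \<equiv> \<lambda>m x n y. l21 y m - l21 x n - l21 (l1 m) n"
  shows "M (M m x n y) (- l20 x y) p z - M (M m x p z) (- l20 x z) n y + M (M n y p z) (- l20 y z) m x
    = l3 x y z - l3 (x + l1 m) (y + l1 n) (z + l1 p)"
proof -
  \<comment> \<open>An entry in the image of \<open>l1\<close> is moved to the last place, where
    \<open>l3_l1\<close> applies.\<close>
  have swap: "l3 x (l1 n) z = - l3 x z (l1 n)" "l3 (l1 m) y z = l3 y z (l1 m)"
    "l3 (l1 m) (l1 n) z = l3 z (l1 m) (l1 n)" "l3 (l1 m) y (l1 p) = - l3 y (l1 m) (l1 p)"
    using skew_l3(2)[of x z "l1 n"] skew_l3(1)[of y "l1 m" z] skew_l3(2)[of y "l1 m" z]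
      skew_l3(1)[of z "l1 m" "l1 n"] skew_l3(2)[of "l1 m" z "l1 n"] skew_l3(1)[of y "l1 m" "l1 p"]
    by auto
  show ?thesis
    by (simp add: M_def lin_simps swap l3_l1 l20_l1 l21_l1_l21
        l21_l1[of n m] l21_l1[of p m] l21_l1[of p n] algebra_simps)
qed

text \<open>The two components of the Jacobiator are \<open>jacobiator_1\<close> and
  \<open>jacobiator_0\<close>. Pairing \<xi> with \<open>- l1 (l3 x y z)\<close> is pairing
  \<open>l1_dual l1 \<xi>\<close> with \<open>l3 x y z\<close>, which moves this term from the
  source to the target and so yields the left translate.\<close>

lemma schouten_linear_bivector:
  "1 / 2 * schouten 2 2 linear_bivector linear_bivector g \<theta>s
    = left_mvf l1 (phi l3) g \<theta>s - right_mvf l1 (phi l3) g \<theta>s"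
proof (cases "length \<theta>s = 3")
  case False
  then show ?thesis by (simp add: schouten_def left_mvf_eq right_mvf_eq phi_def)
next
  case True
  then obtain \<theta>1 \<theta>2 \<theta>3 where "\<theta>s = [\<theta>1, \<theta>2, \<theta>3]" by (auto simp: length_3_conv)
  then obtain m x n y p z where \<theta>s: "\<theta>s = [covec m x, covec n y, covec p z]"
    using covec_exhaust by metis
  let ?c = "\<lambda>m x n y p z. blinfun_apply (linear_bracket (part1 (linear_bracket m x n y)) (part0 (linear_bracket m x n y)) p z) g"
  have "1 / 2 * schouten 2 2 linear_bivector linear_bivector g \<theta>s
      = - (?c m x n y p z - ?c m x p z n y + ?c n y p z m x)"
  proof -
    let ?h = "\<lambda>\<sigma>. mvf_apply linear_bivector (mvf_apply linear_bivector
        (take 2 (permute_list \<sigma> (map blinfun_apply \<theta>s))) # drop 2 (permute_list \<sigma> (map blinfun_apply \<theta>s))) g"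
    \<comment> \<open>For equal arguments of degree 2 the sign in front of the first sum is -1, so
      the two sums add up.\<close>
    have "schouten 2 2 linear_bivector linear_bivector g \<theta>s
        = - 2 * (\<Sum>\<sigma>\<in>unshuffles 2 1. of_int (sign \<sigma>) * ?h \<sigma>)"
      using True by (simp add: schouten_def Let_def)
    also have "\<dots> = - 2 * (?h id - ?h (Transposition.transpose 1 2) +
        ?h (Transposition.transpose 0 1 \<circ> Transposition.transpose 1 2))"
      by (simp only: sum_unshuffles_2_1)
    finally have "schouten 2 2 linear_bivector linear_bivector g \<theta>s = \<dots>" .
    moreover have "mvf_apply linear_bivector [mvf_apply linear_bivector
        [blinfun_apply (covec m x), blinfun_apply (covec n y)], blinfun_apply (covec p z)] g = ?c m x n y p z"
      for m x n y p z
      unfolding mvf_apply_linear_bivector by (simp add: mvf_apply_def linear_bivector_def)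
    ultimately show ?thesis
      by (simp add: permute_list_map_upt \<theta>s upt_rec transpose_def eval_nat_numeral)
  qed
  also have "\<dots> = - (blinfun_apply (fst g) (l3 x y z - l3 (x + l1 m) (y + l1 n) (z + l1 p))
      + blinfun_apply (snd g) (- l1 (l3 x y z)))"
    unfolding jacobiator_1[symmetric] jacobiator_0[symmetric]
    by (simp add: linear_bracket_def covec_apply blin_simps lin_simps)
  also have "\<dots> = left_mvf l1 (phi l3) g \<theta>s - right_mvf l1 (phi l3) g \<theta>s"
    by (simp add: \<theta>s left_mvf_eq right_mvf_eq phi_def tgt_apply src_apply blin_simps l1_dual_apply)
  finally show ?thesis .
qed

section \<open>Pullbacks under the target map and the bracket with the left translate of
  \<open>phi\<close>\<close>

lemma covec_tgt: "blinfun_apply (covec p (- l1 p)) g = blinfun_apply (tgt (action_groupoid l1) g) p"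
  by (simp add: covec_apply tgt_apply blin_simps l1_dual_apply)

text \<open>By \<open>covec_tgt\<close>, \<open>covec p (- l1 p)\<close> is \<open>t\<^sup>*p\<close>.\<close>

lemma linear_bracket_tgt: "linear_bracket p (- l1 p) n y = covec (l21 y p) (- l1 (l21 y p))"
  by (simp add: linear_bracket_def lin_simps l20_l1)

text \<open>The case of \<open>- k\<close>, in the normal form in which the left translate of
  \<open>phi\<close>, with its minus sign, produces it.\<close>

lemma covec_tgt': "blinfun_apply (covec (- k) (l1 k)) g = - blinfun_apply (tgt (action_groupoid l1) g) k"
  using covec_tgt[of "- k"] by (simp add: lin_simps blin_simps)

lemma linear_bracket_tgt': "linear_bracket (- k) (l1 k) n y = covec (- l21 y k) (l1 (l21 y k))"
  using linear_bracket_tgt[of "- k"] by (simp add: lin_simps)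

text \<open>On linear functions the left translate of \<open>phi\<close> gives minus the target
  pullback of a value of \<open>l3\<close>, and bracketing such a pullback with a linear function is
  again a pullback, via \<open>l21\<close>. So the two sums of the Schouten bracket are the two
  sides of \<open>coherence\<close>, paired with the target of \<open>g\<close>.\<close>

lemma schouten_linear_bivector_phi:
  "schouten 2 3 linear_bivector (left_mvf l1 (phi l3)) g \<theta>s = 0"
proof (cases "length \<theta>s = 4")
  case False
  then show ?thesis by (simp add: schouten_def)
next
  case True
  define w where "w i = part0 (\<theta>s ! i)" for i
  define \<tau> where "\<tau> = tgt (action_groupoid l1) g"
  have perm: "permute_list \<sigma> (map blinfun_apply \<theta>s) = [blinfun_apply (\<theta>s ! \<sigma> 0), blinfun_apply (\<theta>s ! \<sigma> 1),
      blinfun_apply (\<theta>s ! \<sigma> 2), blinfun_apply (\<theta>s ! \<sigma> 3)]"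
    if "\<sigma> \<in> unshuffles 3 1 \<or> \<sigma> \<in> unshuffles 2 2" for \<sigma>
  proof -
    have "\<sigma> permutes {..<4}" using that by (auto simp: unshuffles_def)
    then have "\<sigma> i < 4" if "i < 4" for i using that permutes_in_image[of \<sigma> "{..<4}" i] by auto
    then show ?thesis using True by (simp add: permute_list_map_upt upt_rec eval_nat_numeral)
  qed
  have phi_apply: "mvf_apply (left_mvf l1 (phi l3)) [blinfun_apply \<theta>1, blinfun_apply \<theta>2, blinfun_apply \<theta>3]
      = blinfun_apply (covec (- l3 (part0 \<theta>1) (part0 \<theta>2) (part0 \<theta>3)) (l1 (l3 (part0 \<theta>1) (part0 \<theta>2) (part0 \<theta>3))))"
    for \<theta>1 \<theta>2 \<theta>3
    unfolding fun_eq_iff covec_tgt' by (simp add: mvf_apply_def left_mvf_eq phi_def)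
  have bivector_apply: "mvf_apply linear_bivector [blinfun_apply \<theta>1, blinfun_apply \<theta>2]
      = blinfun_apply (linear_bracket (part1 \<theta>1) (part0 \<theta>1) (part1 \<theta>2) (part0 \<theta>2))" for \<theta>1 \<theta>2
    using mvf_apply_linear_bivector[of "part1 \<theta>1" "part0 \<theta>1" "part1 \<theta>2" "part0 \<theta>2"] by simp
  have "(\<Sum>\<sigma>\<in>unshuffles 3 1. let fs = permute_list \<sigma> (map blinfun_apply \<theta>s)
       in of_int (sign \<sigma>) * mvf_apply linear_bivector (mvf_apply (left_mvf l1 (phi l3)) (take 3 fs) # drop 3 fs) g)
     = blinfun_apply \<tau> (\<Sum>\<sigma>\<in>unshuffles 3 1. of_int (sign \<sigma>) *\<^sub>R
          (- l21 (w (\<sigma> 3)) (l3 (w (\<sigma> 0)) (w (\<sigma> 1)) (w (\<sigma> 2)))))"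
    unfolding blinfun.sum_right Let_def
    by (intro sum.cong refl)
      (simp add: perm phi_apply bivector_apply linear_bracket_tgt' covec_tgt' w_def \<tau>_def blin_simps)
  also have "\<dots> = blinfun_apply \<tau> (\<Sum>\<sigma>\<in>unshuffles 2 2. of_int (sign \<sigma>) *\<^sub>R
          l3 (l20 (w (\<sigma> 0)) (w (\<sigma> 1))) (w (\<sigma> 2)) (w (\<sigma> 3)))"
    by (simp only: coherence)
  \<comment> \<open>Only the component \<open>- l20\<close> of the inner bracket enters here, and
    its sign cancels the one of \<open>phi\<close>.\<close>
  also have "\<dots> = (\<Sum>\<sigma>\<in>unshuffles 2 2. let fs = permute_list \<sigma> (map blinfun_apply \<theta>s)
       in of_int (sign \<sigma>) * mvf_apply (left_mvf l1 (phi l3)) (mvf_apply linear_bivector (take 2 fs) # drop 2 fs) g)"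
    unfolding blinfun.sum_right Let_def
    by (intro sum.cong refl)
      (simp add: perm bivector_apply phi_apply covec_tgt covec_tgt' w_def \<tau>_def lin_simps blin_simps linear_bracket_def)
  finally show ?thesis
    using True by (simp add: schouten_def)
qed

lemma quasi_poisson_linear_bivector: "quasi_poisson_groupoid l1 linear_bivector (phi l3)"
  unfolding quasi_poisson_groupoid_def
  using lie_groupoid_action integrates_A_action bivector_field_linear_bivector
    multiplicative_linear_bivector wedge_section_phi schouten_linear_bivector schouten_linear_bivector_phi
  by blast


subsection \<open>The operator \<open>\<delta>\<close> and uniqueness\<close>

text \<open>By the chain rule, at a single arrow the pullback of \<open>f\<close> has the same
  differential as the pullback of the linear function \<open>p\<close> that represents the
  derivative of \<open>f\<close>. This reduces smooth functions to linear ones.\<close>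

lemma differential_tgt:
  assumes "f differentiable (at (tgt (action_groupoid l1) g))"
  obtains p where "differential (\<lambda>h. f (tgt (action_groupoid l1) h)) g = covec p (- l1 p)"
    and "\<And>\<beta>. frechet_derivative f (at (tgt (action_groupoid l1) g)) \<beta> = blinfun_apply \<beta> p"
proof -
  let ?t = "tgt (action_groupoid l1)"
  have der: "(f has_derivative frechet_derivative f (at (?t g))) (at (?t g))"
    using assms by (simp add: frechet_derivative_works)
  obtain p where p: "\<And>\<beta>. frechet_derivative f (at (?t g)) \<beta> = blinfun_apply \<beta> p"
    using linear_functional_on_dual[OF finite_dim_m has_derivative_linear[OF der]] by blast
  have "((\<lambda>h. f (?t h)) has_derivative (\<lambda>v. frechet_derivative f (at (?t g)) (?t v))) (at g)"
    by (rule has_derivative_compose[OF bounded_linear_imp_has_derivative[OF bounded_linear_tgt] der])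
  from frechet_derivative_at[OF this, symmetric]
  have "frechet_derivative (\<lambda>h. f (?t h)) (at g) = blinfun_apply (covec p (- l1 p))"
    by (simp add: p covec_tgt fun_eq_iff)
  then have "differential (\<lambda>h. f (?t h)) g = covec p (- l1 p)"
    by (simp add: differential_def blinfun_apply_inverse)
  then show ?thesis using p that by blast
qed

lemma linear_bivector_differential_tgt:
  assumes "f differentiable (at (tgt (action_groupoid l1) g))"
  shows "linear_bivector g [differential (\<lambda>h. f (tgt (action_groupoid l1) h)) g, covec n y]
    = frechet_derivative f (at (tgt (action_groupoid l1) g)) (anchor_Adual l21 (tgt (action_groupoid l1) g) y)"
  by (rule differential_tgt[OF assms]) (simp add: linear_bracket_tgt covec_tgt anchor_Adual_apply)

text \<open>Boundedness in \<open>y\<close> is checked because \<open>delta_fun\<close> is built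
  with \<open>Blinfun\<close>.\<close>

lemma left_field_delta_fun:
  assumes "f differentiable (at (tgt (action_groupoid l1) g))"
  shows "blinfun_apply (covec n y) (left_field l1 (delta_fun l21 f) g)
    = frechet_derivative f (at (tgt (action_groupoid l1) g)) (anchor_Adual l21 (tgt (action_groupoid l1) g) y)"
proof -
  have "linear (frechet_derivative f (at (tgt (action_groupoid l1) g)))"
    using assms by (simp add: linear_frechet_derivative)
  then have "bounded_linear (\<lambda>y. frechet_derivative f (at (tgt (action_groupoid l1) g))
      (anchor_Adual l21 (tgt (action_groupoid l1) g) y))"
    by (intro bounded_linear_finite_dim[OF finite_dim_x] linear_compose[OF linear_anchor_Adual, unfolded comp_def])
  then show ?thesis
    by (simp add: left_field_def left_vector_def covec_apply delta_fun_def bounded_linear_Blinfun_apply)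
qed

text \<open>For a section \<open>e\<close>, the three terms of \<open>schouten_1_2\<close> match
  those of \<open>delta_formula\<close>: the two with a differential are brackets with target
  pullbacks of pairings of \<open>e\<close>, which give the anchor terms, and the derivative of the
  linear bracket along the left translate gives the term with \<open>l20\<close>.\<close>

lemma delta_Pi_linear_bivector: "delta_Pi_is l1 linear_bivector (delta_fun l21) (delta_sec l20 l21)"
  unfolding delta_Pi_is_def
proof (intro conjI allI impI)
  fix f :: "('m \<Rightarrow>\<^sub>L real) \<Rightarrow> real" and g and \<theta> :: "('m, 'x) arrows \<Rightarrow>\<^sub>L real"
  assume "smooth f"
  then have f: "f differentiable (at (tgt (action_groupoid l1) g))"
    by (rule smooth_imp_differentiable)
  obtain n y where "\<theta> = covec n y" by (rule covec_exhaust[of \<theta>])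
  then show "blinfun_apply \<theta> (left_field l1 (delta_fun l21 f) g)
      = linear_bivector g [differential (\<lambda>h. f (tgt (action_groupoid l1) h)) g, \<theta>]"
    by (simp add: left_field_delta_fun[OF f] linear_bivector_differential_tgt[OF f])
next
  fix e :: "('m \<Rightarrow>\<^sub>L real) \<Rightarrow> ('x \<Rightarrow>\<^sub>L real)"
  assume "smooth e"
  then have e: "e differentiable (at \<alpha>)" for \<alpha> by (rule smooth_imp_differentiable)
  have ex: "(\<lambda>\<beta>. blinfun_apply (e \<beta>) x) differentiable (at \<alpha>)" for x \<alpha>
    using e bounded_linear.has_derivative[OF blinfun.bounded_linear_left]
    unfolding differentiable_def by blast
  show "left_mvf l1 (delta_sec l20 l21 e) = lie_derivative (left_field l1 e) 2 linear_bivector"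
  proof (intro ext)
    fix g \<theta>s
    show "left_mvf l1 (delta_sec l20 l21 e) g \<theta>s = lie_derivative (left_field l1 e) 2 linear_bivector g \<theta>s"
    proof (cases "length \<theta>s = 2")
      case False
      then show ?thesis by (simp add: left_mvf_eq delta_sec_def schouten_def)
    next
      case True
      then obtain \<theta> \<eta> where "\<theta>s = [\<theta>, \<eta>]" by (auto simp: length_2_conv)
      then obtain m x n y where \<theta>s: "\<theta>s = [covec m x, covec n y]"
        using covec_exhaust by metis
      have pair: "blinfun_apply (covec m x) (left_field l1 e p) = blinfun_apply (e (tgt (action_groupoid l1) p)) x"
        for m x p by (simp add: covec_apply left_field_def left_vector_def)
      have "blinfun_apply (linear_bracket m x n y) (left_field l1 e g)
          = - blinfun_apply (e (tgt (action_groupoid l1) g)) (l20 x y)"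
        by (simp add: linear_bracket_def pair blin_simps)
      then show ?thesis
        unfolding \<theta>s schouten_1_2
        by (simp add: pair linear_bivector_differential_tgt[OF ex] left_mvf_eq delta_sec_def
            delta_formula_def bracket_Adual_const)
    qed
  qed
qed

section \<open>Uniqueness of the bivector field\<close>

lemma quasi_poisson_unique:
  assumes qp: "quasi_poisson_groupoid l1 \<pi> (phi l3)"
    and delta: "delta_Pi_is l1 \<pi> (delta_fun l21) (delta_sec l20 l21)"
  shows "\<pi> = linear_bivector"
proof (rule bivector_eqI)
  show mvf: "multivector_field 2 \<pi>" using qp by (simp add: quasi_poisson_groupoid_def)
  have alt: "alternating_form 2 (\<pi> g)" for g using mvf unfolding wedge_section_def by blast
  have alt': "alternating_form 2 (linear_bivector g)" for g
    using bivector_field_linear_bivector unfolding wedge_section_def by blast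
  have mult: "multiplicative (action_groupoid l1) \<pi>" using qp by (simp add: quasi_poisson_groupoid_def)
  have tgt: "\<pi> g [covec p (- l1 p), \<theta>] = linear_bivector g [covec p (- l1 p), \<theta>]" for g p \<theta>
  proof -
    let ?f = "\<lambda>\<beta> :: 'm \<Rightarrow>\<^sub>L real. blinfun_apply \<beta> p"
    have f: "smooth ?f" by (rule smooth_bounded_linear[OF blinfun.bounded_linear_left])
    have "blinfun_apply \<theta> (left_field l1 (delta_fun l21 ?f) g)
        = \<rho> g [differential (\<lambda>h. ?f (tgt (action_groupoid l1) h)) g, \<theta>]"
      if "delta_Pi_is l1 \<rho> (delta_fun l21) (delta_sec l20 l21)" for \<rho>
      using f that unfolding delta_Pi_is_def by blast
    from this[OF delta] this[OF delta_Pi_linear_bivector]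
    have "\<pi> g [differential (\<lambda>h. ?f (tgt (action_groupoid l1) h)) g, \<theta>]
        = linear_bivector g [differential (\<lambda>h. ?f (tgt (action_groupoid l1) h)) g, \<theta>]"
      by (rule trans[OF sym])
    then show ?thesis unfolding covec_tgt[symmetric] differential_blinfun .
  qed
  have invariant: "\<pi> (\<alpha>, \<xi>) [a, b] - linear_bivector (\<alpha>, \<xi>) [a, b]
      = \<pi> (\<alpha>, 0) [a, b] - linear_bivector (\<alpha>, 0) [a, b]" for \<alpha> \<xi> a b
  proof -
    let ?X = "left_field l1 (\<lambda>_. \<xi>) :: ('m, 'x) arrows \<Rightarrow> ('m, 'x) arrows"
    have X: "?X = (\<lambda>_. (0, \<xi>))" by (simp add: left_field_def left_vector_def fun_eq_iff)
    have const: "differential (\<lambda>_ :: ('m, 'x) arrows. c) g = 0" for c g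
      by (simp add: differential_def zero_blinfun_def)
    \<comment> \<open>The left translate of a constant section is a constant vector field, so its
      Lie derivative is just a directional derivative.\<close>
    have lie: "lie_derivative ?X 2 \<rho> g [a, b] = blinfun_apply (differential (\<lambda>p. \<rho> p [a, b]) g) (0, \<xi>)"
      if "\<And>g. alternating_form 2 (\<rho> g)" for \<rho> g
      unfolding X schouten_1_2 by (simp add: const linear_0[OF alternating_form_2(1)[OF that]])
    have "left_mvf l1 (delta_sec l20 l21 (\<lambda>_. \<xi>)) = lie_derivative ?X 2 \<rho>"
      if "delta_Pi_is l1 \<rho> (delta_fun l21) (delta_sec l20 l21)" for \<rho>
      using that smooth_const[of \<xi>] unfolding delta_Pi_is_def by blast
    from trans[OF sym[OF this[OF delta]] this[OF delta_Pi_linear_bivector]]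
    have eq: "blinfun_apply (differential (\<lambda>p. \<pi> p [a, b]) g) (0, \<xi>)
        = blinfun_apply (differential (\<lambda>p. linear_bivector p [a, b]) g) (0, \<xi>)" for g
      by (simp only: lie[OF alt, symmetric] lie[OF alt', symmetric])
    have der: "((\<lambda>t :: real. \<rho> (\<alpha>, t *\<^sub>R \<xi>) [a, b]) has_real_derivative
        blinfun_apply (differential (\<lambda>p. \<rho> p [a, b]) (\<alpha>, t *\<^sub>R \<xi>)) (0, \<xi>)) (at t)"
      if "multivector_field 2 \<rho>" for \<rho> t
    proof -
      have "smooth (\<lambda>p. \<rho> p [a, b])" using that unfolding wedge_section_def by blast
      then have "((\<lambda>p. \<rho> p [a, b]) has_derivative frechet_derivative (\<lambda>p. \<rho> p [a, b]) (at (\<alpha>, t *\<^sub>R \<xi>)))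
          (at (\<alpha>, t *\<^sub>R \<xi>))"
        using smooth_imp_differentiable frechet_derivative_works by blast
      then have "((\<lambda>p. \<rho> p [a, b]) has_derivative blinfun_apply (differential (\<lambda>p. \<rho> p [a, b]) (\<alpha>, t *\<^sub>R \<xi>)))
          (at (\<alpha>, t *\<^sub>R \<xi>))"
        by (simp add: differential_def bounded_linear_Blinfun_apply has_derivative_bounded_linear)
      moreover have "((\<lambda>t. (\<alpha>, t *\<^sub>R \<xi>)) has_derivative (\<lambda>s. (0, s *\<^sub>R \<xi>))) (at t)"
        by (intro has_derivative_Pair has_derivative_const has_derivative_scaleR_left has_derivative_ident)
      ultimately have "((\<lambda>t. \<rho> (\<alpha>, t *\<^sub>R \<xi>) [a, b]) has_derivative
          (\<lambda>s. blinfun_apply (differential (\<lambda>p. \<rho> p [a, b]) (\<alpha>, t *\<^sub>R \<xi>)) (0, s *\<^sub>R \<xi>))) (at t)"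
        by (rule has_derivative_compose[rotated])
      moreover have "blinfun_apply \<theta> (0, s *\<^sub>R \<xi>) = blinfun_apply \<theta> (0, \<xi>) * s"
        for \<theta> :: "('m, 'x) arrows \<Rightarrow>\<^sub>L real" and s
        using blinfun.scaleR_right[of \<theta> s "(0, \<xi>)"] by simp
      ultimately show ?thesis by (simp add: has_field_derivative_def)
    qed
    \<comment> \<open>The difference is constant on the segment from the unit (\<alpha>, 0) to
      (\<alpha>, \<xi>).\<close>
    have "((\<lambda>t :: real. \<pi> (\<alpha>, t *\<^sub>R \<xi>) [a, b] - linear_bivector (\<alpha>, t *\<^sub>R \<xi>) [a, b])
        has_real_derivative 0) (at t)" for t
      using DERIV_diff[OF der[OF mvf] der[OF bivector_field_linear_bivector]] by (simp add: eq)
    from DERIV_isconst_all[of "\<lambda>t. \<pi> (\<alpha>, t *\<^sub>R \<xi>) [a, b] - linear_bivector (\<alpha>, t *\<^sub>R \<xi>) [a, b]" 1 0] this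
    show ?thesis by simp
  qed
  show "\<pi> g [covec m x, covec n y] = blinfun_apply (linear_bracket m x n y) g" for g m x n y
  proof -
    obtain \<alpha> \<xi> where g: "g = (\<alpha>, \<xi>)" by (cases g)
    \<comment> \<open>The first summand is a target pullback, on which the fields agree; the second
      has no first component, so \<open>multiplicative_unit\<close> applies to it at units.\<close>
    have split: "covec m x = covec m (- l1 m) + covec 0 (x + l1 m)" for m x
      by (simp flip: covec_add)
    note lin = linear_add[OF alternating_form_2(1)[OF alt]] linear_add[OF alternating_form_2(2)[OF alt]]
      linear_add[OF alternating_form_2(1)[OF alt']] linear_add[OF alternating_form_2(2)[OF alt']]
    have tgt': "\<pi> h [\<theta>, covec p (- l1 p)] = linear_bivector h [\<theta>, covec p (- l1 p)]" for h p \<theta>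
      using alternating_form_2(3)[OF alt, of h "covec p (- l1 p)" \<theta>]
        alternating_form_2(3)[OF alt', of h "covec p (- l1 p)" \<theta>] tgt by simp
    have "\<pi> (\<alpha>, 0) [covec 0 u, covec 0 v] = linear_bivector (\<alpha>, 0) [covec 0 u, covec 0 v]" for u v
      using multiplicative_unit[OF mvf mult]
        multiplicative_unit[OF bivector_field_linear_bivector multiplicative_linear_bivector] by simp
    then have "\<pi> (\<alpha>, 0) [covec m x, covec n y] = linear_bivector (\<alpha>, 0) [covec m x, covec n y]"
      unfolding split[of m x] split[of n y] by (simp only: lin tgt tgt')
    then show ?thesis
      using invariant[of \<alpha> \<xi> "covec m x" "covec n y"] by (simp add: g)
  qed
qed

end

theorem theorem5p6:
  fixes l1 :: "'m::real_normed_vector \<Rightarrow> 'x::real_normed_vector"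
    and l20 :: "'x \<Rightarrow> 'x \<Rightarrow> 'x"
    and l21 :: "'x \<Rightarrow> 'm \<Rightarrow> 'm"
    and l3 :: "'x \<Rightarrow> 'x \<Rightarrow> 'x \<Rightarrow> 'm"
  assumes finite_dim_m: "\<exists>B :: 'm set. finite B \<and> span B = UNIV"
    and finite_dim_x: "\<exists>B :: 'x set. finite B \<and> span B = UNIV"
    and L_infinity: "two_term_L_infinity l1 l20 l21 l3"
  shows "\<exists>\<pi> :: ('m, 'x) arrows mvf.
    (\<forall>\<pi>'. multivector_field 2 \<pi>' \<and>
       (\<forall>g x y m n.
          \<pi>' g [differential (lin_0 x) g, differential (lin_0 y) g] = - lin_0 (l20 x y) g \<and>
          \<pi>' g [differential (lin_0 x) g, differential (lin_1 m) g] = - lin_1 (l21 x m) g \<and>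
          \<pi>' g [differential (lin_1 m) g, differential (lin_1 n) g] = - lin_1 (l21 (l1 m) n) g)
       \<longleftrightarrow> \<pi>' = \<pi>) \<and>
    (\<forall>\<pi>'. quasi_poisson_groupoid l1 \<pi>' (phi l3) \<and>
       delta_Pi_is l1 \<pi>' (delta_fun l21) (delta_sec l20 l21)
       \<longleftrightarrow> \<pi>' = \<pi>)"
proof -
  interpret finite_dim_L_infinity l1 l20 l21 l3
    using assms by (simp add: finite_dim_L_infinity_def finite_dim_L_infinity_axioms_def)
  have "quasi_poisson_groupoid l1 \<pi>' (phi l3) \<and> delta_Pi_is l1 \<pi>' (delta_fun l21) (delta_sec l20 l21)
      \<longleftrightarrow> \<pi>' = linear_bivector" for \<pi>'
    using quasi_poisson_unique quasi_poisson_linear_bivector delta_Pi_linear_bivector by blast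
  then show ?thesis
    using characterized_bivector by (intro exI[of _ linear_bivector] conjI allI)
qed

end
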